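(* Let $n\ge3$ be odd. For an $n$-tuple $(l_1,\dots,l_n)$ of lines through the origin in $\mathbb R^2$, let $\mathcal S=\mathcal S_n\circ\dots\circ\mathcal S_1$, where $\mathcal S_i$ is the reflection in $l_i$; since $n$ is odd, $\mathcal S$ is a reflection in a line $l_1^*$ through the origin. Let $l_{i+1}^*=\mathcal S_i(l_i^* )$ for $i=1,\dots,n-1$. The map $F:(l_1,\dots,l_n)\mapsto(l_1^*,\dots,l_n^* )$ is a self-map of the torus $\mathbb R^n/(\pi\mathbb Z)^n$ that commutes with the diagonal action of the circle $\mathbb R/\pi\mathbb Z$ (rotating all lines by the same angle). Let $G$ be the induced map on the quotient torus $\mathbb R^{n-1}/(\pi\mathbb Z)^{n-1}$. Then $G$ is measure-preserving and ergodic (with respect to Lebesgue measure).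
   Context: The space of lines through the origin is identified with $\mathbb R/\pi\mathbb Z$ by the direction angle, so that $n$-tuples of such lines form the torus $\mathbb R^n/(\pi\mathbb Z)^n$. The quotient of this torus by the diagonal subgroup $\{(t,\dots,t)\}$ is an $(n-1)$-dimensional torus, with its Lebesgue (Haar) measure. *)

theory Defs
  imports "HOL-Analysis.Analysis"
begin

definition lines :: "(real^2) set set" where
  "lines = {L. subspace L \<and> dim L = 1}"

definition line_at :: "real \<Rightarrow> (real^2) set" where
  "line_at \<alpha> = span {vector [cos \<alpha>, sin \<alpha>]}"

lemma lines_eq_range: "lines = range line_at"
proof (intro equalityI subsetI)
  fix L assume "L \<in> lines"
  then have L: "subspace L" "dim L = 1" by (auto simp: lines_def)
  obtain B where B: "B \<subseteq> L" "independent B" "L \<subseteq> span B" "card B = dim L"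
    using basis_exists[of L] by metis
  then obtain b where Bb: "B = {b}" using L(2) by (metis card_1_singletonE)
  with B have "b \<noteq> 0" by (auto simp: dependent_zero)
  have Lb: "L = span {b}"
    using B L(1) Bb by (intro antisym span_minimal) auto
  define r where "r = norm b"
  have r: "r > 0" "r\<^sup>2 = (b$1)\<^sup>2 + (b$2)\<^sup>2"
    using \<open>b \<noteq> 0\<close> by (simp_all only: r_def zero_less_norm_iff)
      (simp_all add: norm_vec_def L2_set_def sum_2)
  have "(b$1 / r)\<^sup>2 + (b$2 / r)\<^sup>2 = ((b$1)\<^sup>2 + (b$2)\<^sup>2) / r\<^sup>2"
    by (simp add: power_divide add_divide_distrib)
  also have "\<dots> = 1" using r(1) by (simp flip: r(2))
  finally have "(b$1 / r)\<^sup>2 + (b$2 / r)\<^sup>2 = 1" .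
  then obtain \<alpha> where "b$1 / r = cos \<alpha>" "b$2 / r = sin \<alpha>"
    using sincos_total_2pi by metis
  then have "b = r *\<^sub>R vector [cos \<alpha>, sin \<alpha>]"
    using r(1) by (auto simp: vec_eq_iff forall_2 field_simps)
  then have "L = line_at \<alpha>"
    using Lb r(1) span_image_scale[of "{vector [cos \<alpha>, sin \<alpha>] :: real^2}" "\<lambda>_. r"]
    by (simp add: line_at_def)
  then show "L \<in> range line_at" by simp
next
  fix L assume "L \<in> range line_at"
  then obtain \<alpha> where \<alpha>: "L = span {vector [cos \<alpha>, sin \<alpha>]}" by (auto simp: line_at_def)
  have "vector [cos \<alpha>, sin \<alpha>] \<noteq> (0 :: real^2)"
    using sin_zero_abs_cos_one[of \<alpha>] by (auto simp: vec_eq_iff forall_2)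
  then have "dim L = 1" unfolding \<alpha> by (subst dim_span) (simp add: dim_insert)
  then show "L \<in> lines" by (simp add: lines_def \<alpha>)
qed

definition rotation :: "real \<Rightarrow> real^2 \<Rightarrow> real^2" where
  "rotation t x = vector [cos t * x$1 - sin t * x$2, sin t * x$1 + cos t * x$2]"

text \<open>For a subspace \<open>L\<close>, the closest point is the orthogonal projection onto \<open>L\<close>.\<close>

definition reflect_in :: "(real^2) set \<Rightarrow> real^2 \<Rightarrow> real^2" where
  "reflect_in L x = 2 *\<^sub>R closest_point L x - x"

text \<open>\<open>reflections l k\<close> is \<open>S\<^sub>k \<circ> \<dots> \<circ> S\<^sub>1\<close>, where \<open>S\<^sub>i\<close> is the reflection in the line \<open>l i\<close>.\<close>

fun reflections :: "(nat \<Rightarrow> (real^2) set) \<Rightarrow> nat \<Rightarrow> real^2 \<Rightarrow> real^2" where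
  "reflections l 0 = id"
| "reflections l (Suc k) = reflect_in (l (Suc k)) \<circ> reflections l k"

definition composite_line :: "nat \<Rightarrow> (nat \<Rightarrow> (real^2) set) \<Rightarrow> (real^2) set" where
  "composite_line n l = (THE L. L \<in> lines \<and> reflect_in L = reflections l n)"

text \<open>Tuples are indexed by \<open>1, \<dots>, n\<close>; the value at index 0 is never used.\<close>

fun star :: "nat \<Rightarrow> (nat \<Rightarrow> (real^2) set) \<Rightarrow> nat \<Rightarrow> (real^2) set" where
  "star n l 0 = {}"
| "star n l (Suc 0) = composite_line n l"
| "star n l (Suc (Suc i)) = reflect_in (l (Suc i)) ` star n l (Suc i)"

definition line_tuples :: "nat \<Rightarrow> (nat \<Rightarrow> (real^2) set) set" where
  "line_tuples n = (\<Pi>\<^sub>E i\<in>{1..n}. lines)"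

definition star_map :: "nat \<Rightarrow> (nat \<Rightarrow> (real^2) set) \<Rightarrow> (nat \<Rightarrow> (real^2) set)" where
  "star_map n l = (\<lambda>i\<in>{1..n}. star n l i)"

definition rotate_tuple :: "nat \<Rightarrow> real \<Rightarrow> (nat \<Rightarrow> (real^2) set) \<Rightarrow> (nat \<Rightarrow> (real^2) set)" where
  "rotate_tuple n t l = (\<lambda>i\<in>{1..n}. rotation t ` l i)"

text \<open>The coset of \<open>l\<close> modulo the diagonal circle; these cosets are the points of the
  quotient torus.\<close>

definition orbit :: "nat \<Rightarrow> (nat \<Rightarrow> (real^2) set) \<Rightarrow> (nat \<Rightarrow> (real^2) set) set" where
  "orbit n l = range (\<lambda>t. rotate_tuple n t l)"

text \<open>The map induced by \<open>star_map\<close> on cosets, as an image of sets: if \<open>star_map\<close> commutes with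
  the diagonal rotations, the image of a coset is again a coset.\<close>

definition induced_map ::
    "nat \<Rightarrow> (nat \<Rightarrow> (real^2) set) set \<Rightarrow> (nat \<Rightarrow> (real^2) set) set" where
  "induced_map n q = star_map n ` q"

text \<open>Image measure on \<open>f ` space M\<close> with the largest sigma-algebra making \<open>f\<close> measurable.\<close>

definition quotient_measure :: "'a measure \<Rightarrow> ('a \<Rightarrow> 'b) \<Rightarrow> 'b measure" where
  "quotient_measure M f =
     distr M (sigma (f ` space M) {A. A \<subseteq> f ` space M \<and> f -` A \<inter> space M \<in> sets M}) f"

lemma space_quotient_measure [simp]: "space (quotient_measure M f) = f ` space M"
  by (simp add: quotient_measure_def space_measure_of_conv)

lemma sets_quotient_measure:
  fixes M :: "'a measure" and f :: "'a \<Rightarrow> 'b"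
  shows "sets (quotient_measure M f) = {A. A \<subseteq> f ` space M \<and> f -` A \<inter> space M \<in> sets M}"
    (is "_ = ?S")
proof -
  have "sigma_algebra (f ` space M) ?S"
  proof (rule sigma_algebra_iff2[THEN iffD2], intro conjI ballI allI impI)
    show "?S \<subseteq> Pow (f ` space M)" "{} \<in> ?S" by auto
  next
    fix A assume A: "A \<in> ?S"
    have "f -` (f ` space M - A) \<inter> space M = space M - (f -` A \<inter> space M)" by auto
    with A show "f ` space M - A \<in> ?S" by auto
  next
    fix A :: "nat \<Rightarrow> 'b set" assume A: "range A \<subseteq> ?S"
    have "f -` (\<Union>i. A i) \<inter> space M = (\<Union>i. f -` A i \<inter> space M)" by auto
    moreover have "(\<Union>i. f -` A i \<inter> space M) \<in> sets M"
      using A by (intro sets.countable_UN) auto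
    moreover have "(\<Union>i. A i) \<subseteq> f ` space M" using A by blast
    ultimately show "\<Union> (range A) \<in> ?S" by simp
  qed
  from sigma_algebra.sigma_sets_eq[OF this] show ?thesis
    by (simp add: quotient_measure_def, subst sets_measure_of) auto
qed

lemma emeasure_quotient_measure:
  assumes "A \<in> sets (quotient_measure M f)"
  shows "emeasure (quotient_measure M f) A = emeasure M (f -` A \<inter> space M)"
proof -
  let ?S = "{A. A \<subseteq> f ` space M \<and> f -` A \<inter> space M \<in> sets M}"
  have "f \<in> measurable M (sigma (f ` space M) ?S)"
    by (rule measurable_measure_of) auto
  then show ?thesis
    using assms by (simp add: quotient_measure_def emeasure_distr)
qed

text \<open>Normalised Haar measure on the space of lines, identified with the reals modulo \<open>\<pi>\<close> by
  the direction angle: a set of lines is measurable iff its set of angles is Borel, and its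
  measure is the length of that set inside the fundamental domain \<open>[0, \<pi>)\<close>, divided by \<open>\<pi>\<close>.\<close>

definition line_measure :: "(real^2) set measure" where
  "line_measure = quotient_measure (uniform_measure lborel {0..<pi}) line_at"

definition torus_measure :: "nat \<Rightarrow> (nat \<Rightarrow> (real^2) set) measure" where
  "torus_measure n = (\<Pi>\<^sub>M i\<in>{1..n}. line_measure)"

lemma emeasure_line_measure_space: "emeasure line_measure (space line_measure) = 1"
proof -
  have "line_at -` range line_at = UNIV" by auto
  moreover have "emeasure lborel {0..<pi} \<noteq> 0" "emeasure lborel {0..<pi} \<noteq> \<infinity>" by auto
  ultimately show ?thesis
    unfolding line_measure_def
    by (subst emeasure_quotient_measure[OF sets.top])
       (simp_all add: emeasure_uniform_measure ennreal_divide_self)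
qed

lemma space_line_measure: "space line_measure = lines"
  by (simp add: line_measure_def lines_eq_range)

lemma space_torus_measure: "space (torus_measure n) = line_tuples n"
  by (simp add: torus_measure_def line_tuples_def space_PiM space_line_measure)

text \<open>The image of Haar measure under the quotient homomorphism is Haar measure on the quotient.
  As that homomorphism has a continuous section (rotate \<open>l n\<close> to \<open>line_at 0\<close>), the quotient
  sigma-algebra is the Borel one.\<close>

definition quotient_torus :: "nat \<Rightarrow> (nat \<Rightarrow> (real^2) set) set measure" where
  "quotient_torus n = quotient_measure (torus_measure n) (orbit n)"

lemma space_quotient_torus: "space (quotient_torus n) = orbit n ` line_tuples n"
  by (simp add: quotient_torus_def space_torus_measure)

definition measure_preserving :: "'a measure \<Rightarrow> ('a \<Rightarrow> 'a) \<Rightarrow> bool" where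
  "measure_preserving M T \<longleftrightarrow>
     T \<in> measurable M M \<and> (\<forall>A\<in>sets M. emeasure M (T -` A \<inter> space M) = emeasure M A)"

definition ergodic :: "'a measure \<Rightarrow> ('a \<Rightarrow> 'a) \<Rightarrow> bool" where
  "ergodic M T \<longleftrightarrow>
     (\<forall>A\<in>sets M. T -` A \<inter> space M = A \<longrightarrow> A \<in> null_sets M \<or> space M - A \<in> null_sets M)"

end

theory Submission imports Defs "HOL-Probability.Probability_Measure" begin

text \<open>In terms of direction angles the star map is linear: the angles \<open>\<beta>\<close> of the image satisfy
  \<open>\<beta>\<^sub>i + \<beta>\<^sub>i\<^sub>+\<^sub>1 = 2 \<alpha>\<^sub>i\<close> with cyclic indices, so its inverse is the averaging operator
  \<open>(N \<beta>)\<^sub>i = (\<beta>\<^sub>i + \<beta>\<^sub>i\<^sub>+\<^sub>1) / 2\<close>. The image of Haar measure under a surjective homomorphism is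
  translation invariant, hence is Haar measure; this is a Fubini argument.

  For ergodicity, let \<open>E\<close> be an invariant set, lifted to angle tuples. The translations that
  preserve it form a group that contains the diagonal and the lattice of multiples of \<open>\<pi>\<close> and is closed
  under \<open>N\<close>. Since powers of \<open>N\<close> contract the oscillation of a vector, this group is dense. For a box
  \<open>B\<close> with half-open sides, the measure of \<open>E \<inter> (B - x)\<close> is right-continuous in \<open>x\<close>, hence constant;
  averaging it over \<open>x\<close> gives \<open>\<mu> (E \<inter> B) = \<mu> E * \<mu> B\<close>. This extends to all measurable \<open>B\<close>, and
  \<open>B = E\<close> forces \<open>\<mu> E\<close> to be 0 or 1.\<close>

section \<open>The star map in angle coordinates\<close>

text \<open>Encodes partial compositions: the first k reflections compose to the reflection at angle
  \<open>alt_sum \<alpha> k\<close> if k is odd, and to the rotation by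
  \<open>- 2 * alt_sum \<alpha> k\<close> if k is even (see
  \<open>reflections_line_at\<close>).\<close>

definition alt_sum :: "(nat \<Rightarrow> real) \<Rightarrow> nat \<Rightarrow> real" where
  "alt_sum \<alpha> k = (\<Sum>j=1..k. (-1) ^ Suc j * \<alpha> j)"

lemma alt_sum_simps [simp]:
  "alt_sum \<alpha> 0 = 0" "alt_sum \<alpha> (Suc k) = alt_sum \<alpha> k + (-1) ^ k * \<alpha> (Suc k)"
  by (simp_all add: alt_sum_def)

lemma alt_sum_add: "alt_sum (\<lambda>i. \<alpha> i + \<beta> i) k = alt_sum \<alpha> k + alt_sum \<beta> k"
  by (induction k) (simp_all add: algebra_simps)

text \<open>The closed form of the recursion \<beta> 1 = \<open>alt_sum \<alpha> n\<close>, \<beta>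
  (i + 1) = 2 * \<alpha> i - \<beta> i. Coordinates outside 1..n are left alone, so that this map
  and \<open>cyclic_mean\<close> are inverse to each other on all functions.\<close>

definition star_angles :: "nat \<Rightarrow> (nat \<Rightarrow> real) \<Rightarrow> nat \<Rightarrow> real" where
  "star_angles n \<alpha> i =
     (if i \<in> {1..n} then (-1) ^ Suc i * (alt_sum \<alpha> n - 2 * alt_sum \<alpha> (i - 1)) else \<alpha> i)"

definition cyclic_mean :: "nat \<Rightarrow> (nat \<Rightarrow> real) \<Rightarrow> nat \<Rightarrow> real" where
  "cyclic_mean n \<beta> i =
     (if i \<in> {1..n} then (\<beta> i + \<beta> (if i = n then 1 else Suc i)) / 2 else \<beta> i)"

lemma star_angles_add:
  "star_angles n (\<lambda>i. \<alpha> i + \<beta> i) = (\<lambda>i. star_angles n \<alpha> i + star_angles n \<beta> i)"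
  by (rule ext) (simp add: star_angles_def alt_sum_add algebra_simps)

lemma cyclic_mean_diff:
  "cyclic_mean n (\<lambda>i. \<alpha> i - \<beta> i) = (\<lambda>i. cyclic_mean n \<alpha> i - cyclic_mean n \<beta> i)"
  by (rule ext) (simp add: cyclic_mean_def diff_divide_distrib add_divide_distrib)

lemma alt_sum_const: "alt_sum (\<lambda>_. c) k = (if odd k then c else 0)"
  by (induction k) auto

lemma star_angles_const: "odd n \<Longrightarrow> star_angles n (\<lambda>_. c) = (\<lambda>_. c)"
  by (rule ext) (auto simp: star_angles_def alt_sum_const)

text \<open>For i < n this is the recursion behind \<open>star_angles\<close>. Parity enters only in
  the closing relation \<beta> n + \<beta> 1 = 2 * \<alpha> n, where the sign of \<beta> n must be
  +1.\<close>

lemma cyclic_mean_star_angles: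
  assumes "odd n"
  shows "cyclic_mean n (star_angles n \<alpha>) = \<alpha>"
proof
  fix i
  consider "i \<notin> {1..n}" | "i \<in> {1..n}" "i < n" | "i = n" "n \<ge> 1" by fastforce
  then show "cyclic_mean n (star_angles n \<alpha>) i = \<alpha> i"
  proof cases
    case 1
    then show ?thesis by (auto simp: cyclic_mean_def star_angles_def)
  next
    case 2
    then obtain j where "i = Suc j" by (cases i) auto
    with 2 show ?thesis
      by (auto simp: cyclic_mean_def star_angles_def algebra_simps simp flip: power_mult_distrib)
  next
    case 3
    then obtain j where "n = Suc j" by (cases n) auto
    with 3 assms show ?thesis by (auto simp: cyclic_mean_def star_angles_def)
  qed
qed

text \<open>The alternating sum of consecutive means telescopes; k < n keeps the wrap-around term
  out.\<close>

lemma alt_sum_cyclic_mean: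
  assumes "k < n"
  shows "alt_sum (cyclic_mean n \<beta>) k = (\<beta> 1 - (-1) ^ k * \<beta> (Suc k)) / 2"
  using assms by (induction k) (auto simp: cyclic_mean_def field_simps)

lemma star_angles_cyclic_mean:
  assumes "odd n"
  shows "star_angles n (cyclic_mean n \<beta>) = \<beta>"
proof
  fix i
  obtain m where m: "n = Suc m" "even m" using assms by (cases n) auto
  \<comment> \<open>The first m = n - 1 terms telescope to half of \<beta> 1 - \<beta> n, since m is
    even; the wrap-around mean adds half of \<beta> n + \<beta> 1.\<close>
  have s: "alt_sum (cyclic_mean n \<beta>) n = \<beta> 1"
    using alt_sum_cyclic_mean[of m n \<beta>] m by (auto simp: cyclic_mean_def field_simps)
  show "star_angles n (cyclic_mean n \<beta>) i = \<beta> i"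
  proof (cases "i \<in> {1..n}")
    case True
    then obtain j where "i = Suc j" by (cases i) auto
    with True s show ?thesis
      by (auto simp: star_angles_def alt_sum_cyclic_mean field_simps simp flip: power_mult_distrib)
  qed (auto simp: cyclic_mean_def star_angles_def)
qed

section \<open>Iterated averaging, contraction of oscillation, and density\<close>

lemma cyclic_mean_funpow_star_angles:
  assumes "odd n"
  shows "(cyclic_mean n ^^ k) ((star_angles n ^^ k) \<alpha>) = \<alpha>"
proof (induction k)
  case (Suc k)
  have "(cyclic_mean n ^^ Suc k) ((star_angles n ^^ Suc k) \<alpha>)
    = (cyclic_mean n ^^ k) (cyclic_mean n (star_angles n ((star_angles n ^^ k) \<alpha>)))"
    by (simp add: funpow_swap1)
  then show ?case using Suc by (simp add: cyclic_mean_star_angles[OF assms])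
qed simp

lemma cyclic_mean_funpow_diff:
  "(cyclic_mean n ^^ k) (\<lambda>i. \<alpha> i - \<beta> i) =
     (\<lambda>i. (cyclic_mean n ^^ k) \<alpha> i - (cyclic_mean n ^^ k) \<beta> i)"
  by (induction k) (simp_all add: cyclic_mean_diff)

text \<open>Each step spreads a large value from a coordinate to its cyclic predecessor, at the cost of
  halving the excess; after \<open>n - 1\<close> steps it has reached every coordinate.\<close>

lemma cyclic_mean_funpow_lower:
  assumes "\<And>i. i \<in> {1..n} \<Longrightarrow> a \<le> \<beta> i" "a + d \<le> \<beta> 1" "d \<ge> 0" "n \<ge> 1" "k < n"
  shows "(\<forall>i\<in>{1..n}. a \<le> (cyclic_mean n ^^ k) \<beta> i) \<and>
     (\<forall>i\<in>{1..n}. i = 1 \<or> i \<ge> n + 1 - k \<longrightarrow> a + d / 2 ^ k \<le> (cyclic_mean n ^^ k) \<beta> i)"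
  using \<open>k < n\<close>
proof (induction k)
  case 0
  then show ?case using assms by auto
next
  case (Suc k)
  define \<gamma> where "\<gamma> = (cyclic_mean n ^^ k) \<beta>"
  from Suc have 1: "\<And>i. i \<in> {1..n} \<Longrightarrow> a \<le> \<gamma> i"
    and 2: "\<And>i. i \<in> {1..n} \<Longrightarrow> i = 1 \<or> i \<ge> n + 1 - k \<Longrightarrow> a + d / 2 ^ k \<le> \<gamma> i"
    by (auto simp: \<gamma>_def)
  have eq: "(cyclic_mean n ^^ Suc k) \<beta> = cyclic_mean n \<gamma>" by (simp add: \<gamma>_def)
  define s where "s i = (if i = n then 1 else Suc i)" for i
  have s: "s i \<in> {1..n}" if "i \<in> {1..n}" for i using that by (auto simp: s_def)
  have cm: "cyclic_mean n \<gamma> i = (\<gamma> i + \<gamma> (s i)) / 2" if "i \<in> {1..n}" for i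
    using that by (auto simp: cyclic_mean_def s_def)
  show ?case unfolding eq
  proof (intro conjI ballI impI)
    fix i assume i: "i \<in> {1..n}"
    show "a \<le> cyclic_mean n \<gamma> i" using 1[OF i] 1[OF s[OF i]] by (simp add: cm[OF i])
    assume c: "i = 1 \<or> i \<ge> n + 1 - Suc k"
    \<comment> \<open>One of the two averaged values carries the excess: coordinate 1 keeps its own,
      and any other i has a successor reached after k steps, the successor of n being 1.\<close>
    have "a + a + d / 2 ^ k \<le> \<gamma> i + \<gamma> (s i)"
    proof (cases "i = 1")
      case True
      then show ?thesis using 2[OF i] 1[OF s[OF i]] by auto
    next
      case False
      then have "s i = 1 \<or> s i \<ge> n + 1 - k" using c by (auto simp: s_def)
      then show ?thesis using 1[OF i] 2[OF s[OF i]] by auto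
    qed
    then show "a + d / 2 ^ Suc k \<le> cyclic_mean n \<gamma> i" by (simp add: cm[OF i])
  qed
qed

text \<open>If \<beta> 1 lies in the upper half of the interval, its excess c / 2 raises the lower
  bound everywhere after n - 1 steps; otherwise the same argument for the negated vector lowers the
  upper bound. Either way the gain is c / 2 divided by 2 ^ (n - 1).\<close>

lemma cyclic_mean_oscillation:
  assumes "\<And>i. i \<in> {1..n} \<Longrightarrow> a \<le> \<beta> i \<and> \<beta> i \<le> a + c" "c \<ge> 0" "n \<ge> 1"
  shows "\<exists>a'. \<forall>i\<in>{1..n}. a' \<le> (cyclic_mean n ^^ (n - 1)) \<beta> i \<and>
    (cyclic_mean n ^^ (n - 1)) \<beta> i \<le> a' + (1 - 1 / 2 ^ n) * c"
proof -
  let ?N = "cyclic_mean n ^^ (n - 1)"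
  have half: "(c / 2) / 2 ^ (n - 1) = c / 2 ^ n"
    using \<open>n \<ge> 1\<close> by (cases n) auto
  have low: "\<And>i. i \<in> {1..n} \<Longrightarrow> a \<le> \<beta> i" and high: "\<And>i. i \<in> {1..n} \<Longrightarrow> - (a + c) \<le> 0 - \<beta> i"
    using assms by fastforce+
  \<comment> \<open>Negation is written as a difference from 0 so that additivity in the form of
    \<open>cyclic_mean_funpow_diff\<close> applies.\<close>
  have neg: "?N (\<lambda>i. 0 - \<beta> i) i = 0 - ?N \<beta> i" if "i \<in> {1..n}" for i
  proof -
    have "(cyclic_mean n ^^ k) (\<lambda>_. 0) = (\<lambda>_. 0)" for k
      by (induction k) (auto simp: cyclic_mean_def)
    then show ?thesis by (simp add: cyclic_mean_funpow_diff del: diff_0)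
  qed
  have c2: "0 \<le> c / 2" using \<open>c \<ge> 0\<close> by simp
  have i1: "1 \<in> {1..n}" "n - 1 < n" using \<open>n \<ge> 1\<close> by auto
  have all: "i = 1 \<or> i \<ge> n + 1 - (n - 1)" if "i \<in> {1..n}" for i using that by auto
  \<comment> \<open>With excess d = 0, \<open>cyclic_mean_funpow_lower\<close> says only that
    averaging preserves the original bounds.\<close>
  have lo0: "a \<le> ?N \<beta> i" if "i \<in> {1..n}" for i
    using cyclic_mean_funpow_lower[where n = n and \<beta> = \<beta>, OF low, where d = 0 and k = "n - 1"] low i1 that assms by auto
  have hi0: "?N \<beta> i \<le> a + c" if "i \<in> {1..n}" for i
    using cyclic_mean_funpow_lower[where n = n and \<beta> = "\<lambda>i. 0 - \<beta> i", OF high, where d = 0 and k = "n - 1"] high i1 that assms neg[of i]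
    by fastforce
  show ?thesis
  proof (cases "\<beta> 1 \<ge> a + c / 2")
    case True
    have "a + c / 2 ^ n \<le> ?N \<beta> i" if "i \<in> {1..n}" for i
      using cyclic_mean_funpow_lower[where n = n and \<beta> = \<beta>, OF low True c2 \<open>n \<ge> 1\<close> i1(2)]
        that all[OF that] by (simp only: half)
    then show ?thesis using hi0
      by (intro exI[of _ "a + c / 2 ^ n"]) (auto simp: algebra_simps)
  next
    case False
    then have "- (a + c) + c / 2 \<le> 0 - \<beta> 1" by simp
    then have "- (a + c) + c / 2 ^ n \<le> ?N (\<lambda>i. 0 - \<beta> i) i" if "i \<in> {1..n}" for i
      using cyclic_mean_funpow_lower[where n = n and \<beta> = "\<lambda>i. 0 - \<beta> i",
          OF high _ c2 \<open>n \<ge> 1\<close> i1(2)]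
        that all[OF that] by (simp only: half)
    then have "?N \<beta> i \<le> a + c - c / 2 ^ n" if "i \<in> {1..n}" for i
      using that neg by fastforce
    then show ?thesis using lo0
      by (intro exI[of _ a]) (auto simp: algebra_simps)
  qed
qed

lemma floor_divide_bounds:
  fixes a p :: real
  assumes "p > 0"
  shows "of_int \<lfloor>a / p\<rfloor> * p \<le> a" "a < of_int \<lfloor>a / p\<rfloor> * p + p"
proof -
  have "of_int \<lfloor>a / p\<rfloor> \<le> a / p" "a / p < of_int \<lfloor>a / p\<rfloor> + 1"
    by linarith+
  then show "of_int \<lfloor>a / p\<rfloor> * p \<le> a" "a < of_int \<lfloor>a / p\<rfloor> * p + p"
    using pos_le_divide_eq[OF assms] pos_divide_less_eq[OF assms]
    by (auto simp: algebra_simps)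
qed

text \<open>Constants belong to H, so it suffices to make x - h nearly constant; averaging achieves
  this at a geometric rate. The approximation is strictly from above because it later feeds a
  right-continuity argument.\<close>

lemma dense_of_cyclic_mean_closed:
  fixes H :: "(nat \<Rightarrow> real) set"
  assumes "odd n"
    and const: "\<And>c. (\<lambda>_. c) \<in> H"
    and add: "\<And>v w. v \<in> H \<Longrightarrow> w \<in> H \<Longrightarrow> (\<lambda>i. v i + w i) \<in> H"
    and lattice: "\<And>z :: nat \<Rightarrow> int. (\<lambda>i. of_int (z i) * pi) \<in> H"
    and mean: "\<And>v. v \<in> H \<Longrightarrow> cyclic_mean n v \<in> H"
    and "\<epsilon> > 0"
  shows "\<exists>h\<in>H. \<forall>i\<in>{1..n}. x i < h i \<and> h i < x i + \<epsilon>"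
proof -
  have n1: "n \<ge> 1" using \<open>odd n\<close> by (cases n) auto
  define q :: real where "q = 1 - 1 / 2 ^ n"
  have q: "0 \<le> q" "q < 1" by (auto simp: q_def field_simps)
  \<comment> \<open>Reducing modulo \<pi> starts the induction with oscillation at most \<pi>. For
    the next step, the preimage of x under n - 1 averagings is approximated first; averaging then
    returns it to x, keeps h inside H and contracts the error by q.\<close>
  have D: "\<exists>h\<in>H. \<exists>a. \<forall>i\<in>{1..n}. a \<le> x i - h i \<and> x i - h i \<le> a + pi * q ^ k" for x k
  proof (induction k arbitrary: x)
    case 0
    have "0 \<le> x i - of_int \<lfloor>x i / pi\<rfloor> * pi \<and> x i - of_int \<lfloor>x i / pi\<rfloor> * pi \<le> 0 + pi * q ^ 0" for i
      using floor_divide_bounds[OF pi_gt_zero, of "x i"] by auto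
    then show ?case by (intro bexI[OF _ lattice[of "\<lambda>i. \<lfloor>x i / pi\<rfloor>"]] exI[of _ 0]) blast
  next
    case (Suc k)
    let ?N = "cyclic_mean n ^^ (n - 1)" and ?M = "star_angles n ^^ (n - 1)"
    from Suc obtain h a where h: "h \<in> H" "\<And>i. i\<in>{1..n} \<Longrightarrow> a \<le> ?M x i - h i \<and> ?M x i - h i \<le> a + pi * q ^ k"
      by metis
    from cyclic_mean_oscillation[where n = n and \<beta> = "\<lambda>i. ?M x i - h i", OF h(2)] n1 q obtain a' where a':
      "\<forall>i\<in>{1..n}. a' \<le> ?N (\<lambda>i. ?M x i - h i) i \<and> ?N (\<lambda>i. ?M x i - h i) i \<le> a' + q * (pi * q ^ k)"
      by (auto simp: q_def)
    have NH: "(cyclic_mean n ^^ j) h \<in> H" for j by (induction j) (auto simp: h mean)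
    have "?N (\<lambda>i. ?M x i - h i) i = x i - ?N h i" for i
      by (simp add: cyclic_mean_funpow_diff cyclic_mean_funpow_star_angles[OF \<open>odd n\<close>])
    with a' have "\<forall>i\<in>{1..n}. a' \<le> x i - ?N h i \<and> x i - ?N h i \<le> a' + pi * q ^ Suc k"
      by (simp add: mult.left_commute)
    with NH show ?case by blast
  qed
  obtain k where k: "q ^ k < \<epsilon> / (2 * pi)"
    using real_arch_pow_inv[of "\<epsilon> / (2 * pi)" q] q \<open>\<epsilon> > 0\<close> by auto
  from D[of x k] obtain h a where h: "h \<in> H" "\<forall>i\<in>{1..n}. a \<le> x i - h i \<and> x i - h i \<le> a + pi * q ^ k"
    by blast
  have e: "pi * q ^ k < \<epsilon> / 2" using k by (simp add: field_simps)
  show ?thesis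
  proof (intro bexI ballI)
    \<comment> \<open>Since x - h - a lies in [0, \<epsilon> / 2), adding a + 3 * \<epsilon> / 4 to
      h puts it above x by more than \<epsilon> / 4 and at most 3 * \<epsilon> / 4.\<close>
    show "(\<lambda>i. h i + (a + 3 * \<epsilon> / 4)) \<in> H" using add[OF h(1) const] .
    fix i assume "i \<in> {1..n}"
    then have "a \<le> x i - h i" "x i - h i \<le> a + pi * q ^ k" using h by auto
    then show "x i < h i + (a + 3 * \<epsilon> / 4) \<and> h i + (a + 3 * \<epsilon> / 4) < x i + \<epsilon>"
      using e \<open>\<epsilon> > 0\<close> by linarith
  qed
qed

section \<open>Lines and reflections\<close>

lemma closest_point_span_unit:
  fixes u :: "'a::euclidean_space"
  assumes "norm u = 1"
  shows "closest_point (span {u}) x = (x \<bullet> u) *\<^sub>R u"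
proof (rule closest_point_unique[symmetric])
  show "\<forall>z\<in>span {u}. dist x ((x \<bullet> u) *\<^sub>R u) \<le> dist x z"
  proof
    fix z assume "z \<in> span {u}"
    then obtain c where z: "z = c *\<^sub>R u" by (auto simp: span_singleton)
    have uu: "u \<bullet> u = 1" using assms by (simp add: norm_eq_1)
    \<comment> \<open>Pythagoras: the squared distances to an arbitrary point of the line and to the
      projection differ by a square.\<close>
    have "(norm (x - c *\<^sub>R u))\<^sup>2 - (norm (x - (x \<bullet> u) *\<^sub>R u))\<^sup>2 = (c - x \<bullet> u)\<^sup>2"
      unfolding power2_norm_eq_inner
      by (simp add: inner_diff_left inner_diff_right uu inner_commute power2_eq_square algebra_simps)
    then have "(norm (x - (x \<bullet> u) *\<^sub>R u))\<^sup>2 \<le> (norm (x - c *\<^sub>R u))\<^sup>2"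
      by (metis diff_ge_0_iff_ge zero_le_power2)
    then show "dist x ((x \<bullet> u) *\<^sub>R u) \<le> dist x z"
      by (simp add: dist_norm z power2_le_iff_abs_le)
  qed
qed (auto simp: subspace_imp_convex closed_span intro: span_mul span_base)

lemma reflect_in_line_at:
  "reflect_in (line_at a) x =
     vector [cos (2 * a) * x$1 + sin (2 * a) * x$2, sin (2 * a) * x$1 - cos (2 * a) * x$2]"
proof -
  have "norm (vector [cos a, sin a] :: real^2) = 1"
    by (simp add: norm_vec_def L2_set_def sum_2)
  moreover have "sin a * (sin a * x$2) + cos a * (cos a * x$2) = x$2"
    by (simp flip: mult.assoc distrib_right power2_eq_square)
  ultimately show ?thesis
    by (simp add: reflect_in_def line_at_def closest_point_span_unit vec_eq_iff forall_2 inner_vec_def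
        sum_2 cos_double_cos sin_double power2_eq_square)
      (simp add: algebra_simps)
qed

lemma linear_vec2:
  "linear (\<lambda>x :: real^2. vector [a * x$1 + b * x$2, c * x$1 + d * x$2] :: real^2)"
  by (rule linearI) (auto simp: vec_eq_iff forall_2 algebra_simps)

lemma linear_reflect_in_line_at: "linear (reflect_in (line_at a))"
proof -
  have "reflect_in (line_at a) =
    (\<lambda>x. vector [cos (2 * a) * x$1 + sin (2 * a) * x$2, sin (2 * a) * x$1 + (- cos (2 * a)) * x$2])"
    by (auto simp: reflect_in_line_at)
  then show ?thesis by (simp only: linear_vec2)
qed

lemma linear_rotation: "linear (rotation t)"
proof -
  have "rotation t = (\<lambda>x. vector [cos t * x$1 + (- sin t) * x$2, sin t * x$1 + cos t * x$2])"
    by (auto simp: rotation_def)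
  then show ?thesis by (simp only: linear_vec2)
qed

lemma reflect_in_image_line_at: "reflect_in (line_at a) ` line_at b = line_at (2 * a - b)"
proof -
  have "reflect_in (line_at a) (vector [cos b, sin b]) = vector [cos (2 * a - b), sin (2 * a - b)]"
    by (simp add: reflect_in_line_at cos_diff sin_diff algebra_simps)
  then show ?thesis
    using linear_span_image[OF linear_reflect_in_line_at, of a "{vector [cos b, sin b]}"]
    by (simp add: line_at_def[of b] line_at_def[of "2 * a - b"])
qed

lemma rotation_image_line_at: "rotation t ` line_at b = line_at (b + t)"
proof -
  have "rotation t (vector [cos b, sin b]) = vector [cos (b + t), sin (b + t)]"
    by (simp add: rotation_def cos_add sin_add algebra_simps)
  then show ?thesis
    using linear_span_image[OF linear_rotation, of t "{vector [cos b, sin b]}"]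
    by (simp add: line_at_def)
qed

text \<open>A line is recovered from its reflection as the set of fixed points.\<close>

lemma inj_on_reflect_in: "inj_on reflect_in lines"
proof (rule inj_onI)
  fix K L assume "K \<in> lines" "L \<in> lines" and eq: "reflect_in K = reflect_in L"
  have "M = {x. reflect_in M x = x}" if "M \<in> lines" for M
  proof -
    have "closed M" "M \<noteq> {}"
      using that by (auto simp: lines_def closed_subspace dest: subspace_0)
    moreover have "reflect_in M x = x \<longleftrightarrow> closest_point M x = x" for x
    proof -
      have "reflect_in M x = x \<longleftrightarrow> 2 *\<^sub>R closest_point M x = 2 *\<^sub>R x"
        by (auto simp: reflect_in_def algebra_simps scaleR_2)
      then show ?thesis by simp
    qed
    ultimately show ?thesis by (simp add: closest_point_refl)
  qed
  with \<open>K \<in> lines\<close> \<open>L \<in> lines\<close> eq show "K = L" by metis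
qed

section \<open>Direction angles modulo \<pi>\<close>

lemma line_at_eq_iff: "line_at a = line_at b \<longleftrightarrow> (\<exists>k::int. a - b = of_int k * pi)"
proof
  assume "line_at a = line_at b"
  then have "vector [cos a, sin a] \<in> span {vector [cos b, sin b] :: real^2}"
    unfolding line_at_def by (metis insertI1 span_base)
  then obtain c where "vector [cos a, sin a] = c *\<^sub>R (vector [cos b, sin b] :: real^2)"
    by (auto simp: span_singleton)
  then have "cos a = c * cos b" "sin a = c * sin b"
    by (simp_all add: vec_eq_iff forall_2)
  \<comment> \<open>Eliminating c between the two coordinate equations leaves the sine of the
    difference.\<close>
  then have "sin (a - b) = 0" by (simp add: sin_diff)
  then show "\<exists>k::int. a - b = of_int k * pi" by (simp add: sin_zero_iff_int2)
next
  assume "\<exists>k::int. a - b = of_int k * pi"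
  then obtain k :: int where "a = b + of_int k * pi" by (auto simp: algebra_simps)
  then have *: "vector [cos a, sin a] = cos (of_int k * pi) *\<^sub>R (vector [cos b, sin b] :: real^2)"
    by (simp add: vec_eq_iff forall_2 cos_add sin_add sin_zero_iff_int2 flip: mult.commute)
  \<comment> \<open>Shifting by a multiple of \<pi> scales the direction vector by this factor; a
    nonzero factor does not change the span.\<close>
  have "cos (of_int k * pi) \<noteq> 0"
    by (metis sin_zero_abs_cos_one sin_zero_iff_int2 abs_zero zero_neq_one)
  then show "line_at a = line_at b"
    using span_image_scale[of "{vector [cos b, sin b] :: real^2}" "\<lambda>_. cos (of_int k * pi)"]
    by (simp add: line_at_def *)
qed

text \<open>A section of \<open>line_at\<close> with values in [0, \<pi>); for a line the choice is
  unique, by \<open>line_angle_line_at\<close>.\<close>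

definition line_angle :: "(real^2) set \<Rightarrow> real" where
  "line_angle L = (SOME a. 0 \<le> a \<and> a < pi \<and> line_at a = L)"

lemma line_angle_line_at: "line_angle (line_at a) = a - of_int \<lfloor>a / pi\<rfloor> * pi"
  unfolding line_angle_def
proof (rule some_equality)
  show "0 \<le> a - of_int \<lfloor>a / pi\<rfloor> * pi \<and> a - of_int \<lfloor>a / pi\<rfloor> * pi < pi
    \<and> line_at (a - of_int \<lfloor>a / pi\<rfloor> * pi) = line_at a"
    using floor_divide_bounds[OF pi_gt_zero, of a]
    by (auto simp: line_at_eq_iff intro!: exI[of _ "- \<lfloor>a / pi\<rfloor>"])
next
  fix b assume b: "0 \<le> b \<and> b < pi \<and> line_at b = line_at a"
  then obtain k :: int where "b - a = of_int k * pi" by (auto simp: line_at_eq_iff)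
  with b have "a = b - of_int k * pi" by simp
  moreover from this b have "\<lfloor>a / pi\<rfloor> = - k" by (auto simp: floor_eq_iff field_simps)
  ultimately show "b = a - of_int \<lfloor>a / pi\<rfloor> * pi" by simp
qed

lemma line_at_line_angle: "L \<in> lines \<Longrightarrow> line_at (line_angle L) = L"
proof -
  assume "L \<in> lines"
  then obtain a where "L = line_at a" by (auto simp: lines_eq_range)
  moreover have "line_at (a - of_int \<lfloor>a / pi\<rfloor> * pi) = line_at a"
    unfolding line_at_eq_iff by (rule exI[of _ "- \<lfloor>a / pi\<rfloor>"]) simp
  ultimately show ?thesis by (simp add: line_angle_line_at)
qed

lemma line_at_in_lines [simp]: "line_at a \<in> lines"
  by (simp add: lines_eq_range)

section \<open>Tuples of lines and the star map in terms of angles\<close>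

definition tuple_at :: "nat \<Rightarrow> (nat \<Rightarrow> real) \<Rightarrow> nat \<Rightarrow> (real^2) set" where
  "tuple_at n \<alpha> = (\<lambda>i\<in>{1..n}. line_at (\<alpha> i))"

lemma tuple_at_in [simp]: "tuple_at n \<alpha> \<in> line_tuples n"
  by (auto simp: tuple_at_def line_tuples_def)

lemma tuple_at_line_angle: "l \<in> line_tuples n \<Longrightarrow> tuple_at n (\<lambda>i. line_angle (l i)) = l"
  by (auto simp: tuple_at_def line_tuples_def line_at_line_angle fun_eq_iff PiE_def
      extensional_def Pi_iff)

lemma line_tuples_eq_range: "line_tuples n = range (tuple_at n)"
  using tuple_at_line_angle by (auto simp: image_iff) metis

text \<open>A reflection matrix depends on twice the angle, so a reflection followed by another is a
  rotation by twice the angle difference. The empty composition counts as the rotation by 0.\<close>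

lemma reflections_line_at:
  assumes "\<And>i. i \<in> {1..k} \<Longrightarrow> l i = line_at (\<alpha> i)"
  shows "reflections l k =
    (if odd k then reflect_in (line_at (alt_sum \<alpha> k)) else rotation (- 2 * alt_sum \<alpha> k))"
  using assms
proof (induction k)
  case 0
  show ?case by (rule ext) (simp add: rotation_def vec_eq_iff forall_2)
next
  case (Suc k)
  have IH: "reflections l k =
    (if odd k then reflect_in (line_at (alt_sum \<alpha> k)) else rotation (- 2 * alt_sum \<alpha> k))"
    using Suc by simp
  have l: "l (Suc k) = line_at (\<alpha> (Suc k))" using Suc by simp
  show ?case
    by (rule ext) (auto simp: IH l reflect_in_line_at rotation_def vec_eq_iff forall_2 cos_add sin_add
        cos_diff sin_diff algebra_simps)
qed

lemma reflections_tuple_at: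
  "odd n \<Longrightarrow> reflections (tuple_at n \<alpha>) n = reflect_in (line_at (alt_sum \<alpha> n))"
  by (subst reflections_line_at[where \<alpha> = \<alpha>]) (auto simp: tuple_at_def)

lemma ex1_reflection_line:
  assumes "odd n" "l \<in> line_tuples n"
  shows "\<exists>!L. L \<in> lines \<and> reflect_in L = reflections l n"
proof -
  from assms obtain \<alpha> where "l = tuple_at n \<alpha>" by (auto simp: line_tuples_eq_range)
  then show ?thesis
    using inj_on_reflect_in reflections_tuple_at[OF \<open>odd n\<close>]
    by (metis inj_onD line_at_in_lines)
qed

text \<open>The composite line has angle \<open>alt_sum \<alpha> n\<close>, and reflecting the line
  at angle b in the line at angle a gives angle 2 * a - b, which is the recursion solved by
  \<open>star_angles\<close>.\<close>

lemma star_map_tuple_at: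
  assumes "odd n"
  shows "star_map n (tuple_at n \<alpha>) = tuple_at n (star_angles n \<alpha>)"
proof -
  have c: "composite_line n (tuple_at n \<alpha>) = line_at (alt_sum \<alpha> n)"
    unfolding composite_line_def
    by (rule the1_equality[OF ex1_reflection_line]) (auto simp: assms reflections_tuple_at)
  have "i < n \<Longrightarrow> star n (tuple_at n \<alpha>) (Suc i) = line_at (star_angles n \<alpha> (Suc i))" for i
  proof (induction i)
    case 0
    then show ?case by (simp add: c star_angles_def)
  next
    case (Suc i)
    then show ?case
      by (simp add: tuple_at_def reflect_in_image_line_at)
        (auto simp: star_angles_def algebra_simps simp flip: power_mult_distrib)
  qed
  then have "star n (tuple_at n \<alpha>) i = line_at (star_angles n \<alpha> i)" if "i \<in> {1..n}" for i
    using that by (cases i) auto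
  then show ?thesis
    by (auto simp: star_map_def tuple_at_def[of n "star_angles n \<alpha>"] fun_eq_iff)
qed

lemma rotate_tuple_tuple_at: "rotate_tuple n t (tuple_at n \<alpha>) = tuple_at n (\<lambda>i. \<alpha> i + t)"
  by (auto simp: rotate_tuple_def tuple_at_def rotation_image_line_at fun_eq_iff)

lemma star_map_rotate_tuple:
  assumes "odd n" "l \<in> line_tuples n"
  shows "star_map n (rotate_tuple n t l) = rotate_tuple n t (star_map n l)"
  using assms
  by (auto simp: line_tuples_eq_range rotate_tuple_tuple_at star_map_tuple_at star_angles_add
      star_angles_const)

lemma induced_map_orbit:
  assumes "odd n" "l \<in> line_tuples n"
  shows "induced_map n (orbit n l) = orbit n (star_map n l)"
  using assms by (simp add: induced_map_def orbit_def image_image star_map_rotate_tuple)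

lemma orbit_tuple_at: "orbit n (tuple_at n (\<lambda>i. \<alpha> i + t)) = orbit n (tuple_at n \<alpha>)"
proof -
  have "(\<lambda>s. tuple_at n (\<lambda>i. \<alpha> i + (t + s))) ` UNIV = (\<lambda>s. tuple_at n (\<lambda>i. \<alpha> i + s)) ` range ((+) t)"
    unfolding image_image ..
  then show ?thesis by (simp add: orbit_def rotate_tuple_tuple_at add.assoc)
qed

section \<open>Haar measure on the torus\<close>

lemma measurable_line_at [measurable]: "line_at \<in> borel \<rightarrow>\<^sub>M line_measure"
proof (rule measurableI)
  fix A assume "A \<in> sets line_measure"
  then show "line_at -` A \<inter> space borel \<in> sets borel"
    by (simp add: line_measure_def sets_quotient_measure)
qed (simp add: space_line_measure)

text \<open>Pulled back along \<open>line_at\<close>, the section becomes reduction modulo \<pi>, a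
  Borel function.\<close>

lemma measurable_line_angle [measurable]: "line_angle \<in> line_measure \<rightarrow>\<^sub>M borel"
proof (rule measurableI)
  fix B :: "real set" assume B [measurable]: "B \<in> sets borel"
  have "line_at -` (line_angle -` B \<inter> lines) = {a. a - of_int \<lfloor>a / pi\<rfloor> * pi \<in> B}"
    by (auto simp: line_angle_line_at)
  also have "\<dots> \<in> sets borel" by measurable
  finally show "line_angle -` B \<inter> space line_measure \<in> sets line_measure"
    by (simp add: line_measure_def sets_quotient_measure) (auto simp: lines_eq_range)
qed simp

lemma emeasure_line_measure:
  assumes "A \<in> sets line_measure"
  shows "emeasure line_measure A = emeasure lborel ({0..<pi} \<inter> line_at -` A) / ennreal pi"
proof -
  have "line_at -` A \<in> sets borel"
    using measurable_sets[OF measurable_line_at assms] by simp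
  then show ?thesis
    using assms unfolding line_measure_def
    by (subst emeasure_quotient_measure) (auto simp: emeasure_uniform_measure)
qed

section \<open>Translation invariance of the measure on lines and on the torus\<close>

lemma emeasure_lborel_shift:
  fixes X :: "real set"
  assumes "X \<in> sets borel"
  shows "emeasure lborel {a. c + a \<in> X} = emeasure lborel X"
proof -
  have "emeasure lborel X = emeasure (distr lborel borel ((+) c)) X"
    by (simp add: lborel_distr_plus)
  also have "\<dots> = emeasure lborel {a. c + a \<in> X}"
    using assms by (subst emeasure_distr) (auto simp: vimage_def)
  finally show ?thesis ..
qed

text \<open>By periodicity the shift may be taken as w in [0, p). The shifted window from w to p + w
  is cut at p, and its upper piece is moved back by one period to fill [0, w).\<close>

lemma emeasure_lborel_periodic_shift:
  fixes B :: "real set"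
  assumes B [measurable]: "B \<in> sets borel" and "p > 0"
    and periodic: "\<And>a k. a + of_int k * p \<in> B \<longleftrightarrow> a \<in> B"
  shows "emeasure lborel ({0..<p} \<inter> {a. v + a \<in> B}) = emeasure lborel ({0..<p} \<inter> B)"
proof -
  define w where "w = v - of_int \<lfloor>v / p\<rfloor> * p"
  have w: "0 \<le> w" "w < p"
    using floor_divide_bounds[OF \<open>p > 0\<close>, of v] by (simp_all add: w_def)
  have "v + a \<in> B \<longleftrightarrow> w + a \<in> B" for a
    using periodic[of "w + a" "\<lfloor>v / p\<rfloor>"] by (simp add: w_def algebra_simps)
  then have "{0..<p} \<inter> {a. v + a \<in> B} = {a. w + a \<in> {w..<p + w} \<inter> B}" by auto
  then have "emeasure lborel ({0..<p} \<inter> {a. v + a \<in> B}) = emeasure lborel ({w..<p + w} \<inter> B)"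
    using emeasure_lborel_shift[of "{w..<p + w} \<inter> B" w] by simp
  also have "{w..<p + w} \<inter> B = ({w..<p} \<inter> B) \<union> ({p..<p + w} \<inter> B)" using w by auto
  also have "emeasure lborel \<dots> = emeasure lborel ({w..<p} \<inter> B) + emeasure lborel ({p..<p + w} \<inter> B)"
    by (rule plus_emeasure[symmetric]) auto
  also have "emeasure lborel ({p..<p + w} \<inter> B) = emeasure lborel {a. p + a \<in> {p..<p + w} \<inter> B}"
    by (rule emeasure_lborel_shift[symmetric]) simp
  also have "{a. p + a \<in> {p..<p + w} \<inter> B} = {0..<w} \<inter> B"
    using periodic[of _ 1] by (auto simp: add.commute)
  also have "emeasure lborel ({w..<p} \<inter> B) + emeasure lborel ({0..<w} \<inter> B)
    = emeasure lborel (({w..<p} \<inter> B) \<union> ({0..<w} \<inter> B))"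
    by (rule plus_emeasure) auto
  also have "({w..<p} \<inter> B) \<union> ({0..<w} \<inter> B) = {0..<p} \<inter> B" using w by auto
  finally show ?thesis .
qed

lemma line_at_add_line_angle: "line_at (v + line_angle (line_at a)) = line_at (v + a)"
  unfolding line_at_eq_iff line_angle_line_at by (rule exI[of _ "- \<lfloor>a / pi\<rfloor>"]) simp

lemma emeasure_line_measure_shift:
  assumes A: "A \<in> sets line_measure"
  shows "emeasure line_measure ((\<lambda>L. line_at (v + line_angle L)) -` A \<inter> lines) = emeasure line_measure A"
proof -
  have "(\<lambda>L. line_at (v + line_angle L)) -` A \<inter> space line_measure \<in> sets line_measure"
    using A by measurable
  then have S: "(\<lambda>L. line_at (v + line_angle L)) -` A \<inter> lines \<in> sets line_measure"
    by (simp add: space_line_measure)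
  have eq: "line_at -` ((\<lambda>L. line_at (v + line_angle L)) -` A \<inter> lines) = {a. v + a \<in> line_at -` A}"
    by (auto simp: line_at_add_line_angle)
  have per: "line_at (a + of_int k * pi) = line_at a" for a k
    unfolding line_at_eq_iff by (rule exI[of _ k]) simp
  have "line_at -` A \<in> sets borel" using measurable_sets[OF measurable_line_at A] by simp
  then show ?thesis
    unfolding emeasure_line_measure[OF S] emeasure_line_measure[OF A] eq
    by (subst emeasure_lborel_periodic_shift) (auto simp: per)
qed

lemma prob_space_line_measure: "prob_space line_measure"
  by (rule prob_spaceI) (rule emeasure_line_measure_space)

interpretation line_product: product_sigma_finite "\<lambda>_ :: nat. line_measure"
  by (simp add: product_sigma_finite_def prob_space_line_measure prob_space_imp_sigma_finite)

lemma prob_space_torus_measure: "prob_space (torus_measure n)"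
proof (rule prob_spaceI)
  show "emeasure (torus_measure n) (space (torus_measure n)) = 1"
    unfolding torus_measure_def space_PiM
    by (subst line_product.emeasure_PiM) (auto simp: emeasure_line_measure_space)
qed

lemma measurable_torus_component [measurable (raw)]:
  "i \<in> {1..n} \<Longrightarrow> (\<lambda>l. l i) \<in> torus_measure n \<rightarrow>\<^sub>M line_measure"
  unfolding torus_measure_def by (rule measurable_component_singleton)

lemma measurable_torus_angle:
  "i \<in> {1..n} \<Longrightarrow> (\<lambda>l. line_angle (l i)) \<in> borel_measurable (torus_measure n)"
  by measurable

lemma measurable_tuple_at:
  assumes "\<And>i. i \<in> {1..n} \<Longrightarrow> (\<lambda>x. f x i) \<in> borel_measurable M"
  shows "(\<lambda>x. tuple_at n (f x)) \<in> M \<rightarrow>\<^sub>M torus_measure n"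
  unfolding torus_measure_def tuple_at_def
  by (intro measurable_restrict measurable_compose[OF _ measurable_line_at] assms)

text \<open>Translation of the torus by the class of v. It is written through representatives in [0,
  \<pi>), on which the result does not depend by \<open>shift_tuple_at\<close>.\<close>

definition shift_tuple :: "nat \<Rightarrow> (nat \<Rightarrow> real) \<Rightarrow> (nat \<Rightarrow> (real^2) set) \<Rightarrow> nat \<Rightarrow> (real^2) set" where
  "shift_tuple n v l = tuple_at n (\<lambda>i. v i + line_angle (l i))"

lemma tuple_at_cong: "(\<And>i. i \<in> {1..n} \<Longrightarrow> \<alpha> i = \<beta> i) \<Longrightarrow> tuple_at n \<alpha> = tuple_at n \<beta>"
  by (simp add: tuple_at_def cong: restrict_cong)

lemma shift_tuple_at: "shift_tuple n v (tuple_at n \<alpha>) = tuple_at n (\<lambda>i. v i + \<alpha> i)"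
  unfolding shift_tuple_def by (simp add: tuple_at_def line_at_add_line_angle cong: restrict_cong)

lemma measurable_shift_tuple [measurable]: "shift_tuple n v \<in> torus_measure n \<rightarrow>\<^sub>M torus_measure n"
  unfolding shift_tuple_def
  by (intro measurable_tuple_at borel_measurable_add borel_measurable_const measurable_torus_angle)

text \<open>Joint measurability of the group operation, as required for exchanging
  integrals.\<close>

lemma measurable_shift_tuple_pair [measurable]:
  "(\<lambda>(l, m). shift_tuple n (\<lambda>i. line_angle (l i)) m) \<in> torus_measure n \<Otimes>\<^sub>M torus_measure n \<rightarrow>\<^sub>M torus_measure n"
  unfolding shift_tuple_def case_prod_beta
  by (intro measurable_tuple_at borel_measurable_add measurable_compose[OF measurable_fst]
      measurable_compose[OF measurable_snd] measurable_torus_angle)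

text \<open>Translation acts coordinatewise, so preimages of rectangles are rectangles with
  translated sides, and rectangles determine the product measure.\<close>

lemma distr_shift_tuple: "distr (torus_measure n) (torus_measure n) (shift_tuple n v) = torus_measure n"
  unfolding torus_measure_def
proof (rule line_product.PiM_eqI)
  fix A assume A: "\<And>i. i \<in> {1..n} \<Longrightarrow> A i \<in> sets line_measure"
  let ?r = "\<lambda>i L. line_at (v i + line_angle L)"
  let ?T = "\<Pi>\<^sub>M i\<in>{1..n}. line_measure"
  have r: "?r i -` A i \<inter> lines \<in> sets line_measure" if "i \<in> {1..n}" for i
  proof -
    have "?r i -` A i \<inter> space line_measure \<in> sets line_measure"
      using A[OF that] by measurable
    then show ?thesis by (simp add: space_line_measure)
  qed
  have "shift_tuple n v -` Pi\<^sub>E {1..n} A \<inter> space ?T = (\<Pi>\<^sub>E i\<in>{1..n}. ?r i -` A i \<inter> lines)"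
    by (auto simp: space_PiM space_line_measure shift_tuple_def tuple_at_def PiE_iff)
  then have "emeasure (distr ?T ?T (shift_tuple n v)) (Pi\<^sub>E {1..n} A)
    = emeasure ?T (\<Pi>\<^sub>E i\<in>{1..n}. ?r i -` A i \<inter> lines)"
    using A measurable_shift_tuple[of n v]
    by (subst emeasure_distr) (auto simp: torus_measure_def intro!: sets_PiM_I_finite)
  also have "\<dots> = (\<Prod>i\<in>{1..n}. emeasure line_measure (A i))"
    using r A by (subst line_product.emeasure_PiM) (auto simp: emeasure_line_measure_shift intro!: prod.cong)
  finally show "emeasure (distr ?T ?T (shift_tuple n v)) (Pi\<^sub>E {1..n} A) =
    (\<Prod>i\<in>{1..n}. emeasure line_measure (A i))" .
qed auto

lemma nn_integral_shift_tuple: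
  assumes [measurable]: "f \<in> borel_measurable (torus_measure n)"
  shows "(\<integral>\<^sup>+ l. f (shift_tuple n v l) \<partial>torus_measure n) = (\<integral>\<^sup>+ l. f l \<partial>torus_measure n)"
  by (subst distr_shift_tuple[of n v, symmetric]) (simp add: nn_integral_distr)

text \<open>Here the translating element is integrated and the translated one is fixed;
  commutativity of the torus exchanges their roles.\<close>

lemma nn_integral_shift_tuple':
  assumes [measurable]: "f \<in> borel_measurable (torus_measure n)" and m: "m \<in> line_tuples n"
  shows "(\<integral>\<^sup>+ l. f (shift_tuple n (\<lambda>i. line_angle (l i)) m) \<partial>torus_measure n) = (\<integral>\<^sup>+ l. f l \<partial>torus_measure n)"
proof -
  have "shift_tuple n (\<lambda>i. line_angle (l i)) m = shift_tuple n (\<lambda>i. line_angle (m i)) l" for l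
    by (simp add: shift_tuple_def add.commute)
  then show ?thesis by (simp add: nn_integral_shift_tuple)
qed

section \<open>The star map preserves Haar measure\<close>

lemma star_map_eq:
  assumes "odd n" "l \<in> line_tuples n"
  shows "star_map n l = tuple_at n (star_angles n (\<lambda>i. line_angle (l i)))"
  using star_map_tuple_at[OF assms(1), of "\<lambda>i. line_angle (l i)"] tuple_at_line_angle[OF assms(2)]
  by simp

lemma measurable_star_map:
  assumes "odd n"
  shows "star_map n \<in> torus_measure n \<rightarrow>\<^sub>M torus_measure n"
proof -
  have s: "(\<lambda>l. alt_sum (\<lambda>i. line_angle (l i)) k) \<in> borel_measurable (torus_measure n)" if "k \<le> n" for k
    unfolding alt_sum_def using that
    by (intro borel_measurable_sum borel_measurable_times borel_measurable_const measurable_torus_angle) auto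
  have "(\<lambda>l. tuple_at n (star_angles n (\<lambda>i. line_angle (l i)))) \<in> torus_measure n \<rightarrow>\<^sub>M torus_measure n"
  proof (rule measurable_tuple_at)
    fix i assume i: "i \<in> {1..n}"
    then have "i - 1 \<le> n" by auto
    from s[OF this] s[of n] i
    show "(\<lambda>l. star_angles n (\<lambda>i. line_angle (l i)) i) \<in> borel_measurable (torus_measure n)"
      by (simp add: star_angles_def)
  qed
  then show ?thesis
    by (rule measurable_cong[THEN iffD1, rotated]) (simp add: space_torus_measure star_map_eq[OF assms])
qed

lemma star_map_shift_tuple:
  assumes "odd n" "l \<in> line_tuples n"
  shows "star_map n (shift_tuple n v l) = shift_tuple n (star_angles n v) (star_map n l)"
proof -
  from assms obtain \<alpha> where "l = tuple_at n \<alpha>" by (auto simp: line_tuples_eq_range)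
  then show ?thesis
    by (simp add: shift_tuple_at star_map_tuple_at[OF assms(1)] star_angles_add)
qed

lemma nn_integral_star_map:
  assumes "odd n" and f [measurable]: "f \<in> borel_measurable (torus_measure n)"
  shows "(\<integral>\<^sup>+ l. f (star_map n l) \<partial>torus_measure n) = (\<integral>\<^sup>+ l. f l \<partial>torus_measure n)"
proof -
  let ?T = "torus_measure n"
  interpret T: prob_space ?T by (rule prob_space_torus_measure)
  interpret TT: pair_sigma_finite ?T ?T ..
  note [measurable] = measurable_star_map[OF \<open>odd n\<close>]
  have *: "(\<integral>\<^sup>+ l. f (star_map n l) \<partial>?T) = (\<integral>\<^sup>+ l. f (shift_tuple n (\<lambda>i. line_angle (m i)) (star_map n l)) \<partial>?T)"
    for m
  proof -
    \<comment> \<open>The preimage of the angles of m under \<open>star_angles\<close>: translating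
      l by v before the star map translates its value by m.\<close>
    define v where "v = cyclic_mean n (\<lambda>i. line_angle (m i))"
    have "(\<integral>\<^sup>+ l. f (star_map n l) \<partial>?T) = (\<integral>\<^sup>+ l. f (star_map n (shift_tuple n v l)) \<partial>?T)"
      by (rule nn_integral_shift_tuple[symmetric]) measurable
    also have "\<dots> = (\<integral>\<^sup>+ l. f (shift_tuple n (\<lambda>i. line_angle (m i)) (star_map n l)) \<partial>?T)"
      by (intro nn_integral_cong)
        (simp add: space_torus_measure star_map_shift_tuple[OF \<open>odd n\<close>] v_def
          star_angles_cyclic_mean[OF \<open>odd n\<close>])
    finally show ?thesis .
  qed
  \<comment> \<open>By \<open>*\<close> the integral may be averaged over all m. After exchanging
    the integrals, the inner one over m is the integral of f, whatever the point
    \<open>star_map n l\<close> is.\<close>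
  have "(\<integral>\<^sup>+ l. f (star_map n l) \<partial>?T) = (\<integral>\<^sup>+ m. (\<integral>\<^sup>+ l. f (star_map n l) \<partial>?T) \<partial>?T)"
    by (simp add: T.emeasure_space_1)
  also have "\<dots> = (\<integral>\<^sup>+ m. (\<integral>\<^sup>+ l. f (shift_tuple n (\<lambda>i. line_angle (m i)) (star_map n l)) \<partial>?T) \<partial>?T)"
    by (rule nn_integral_cong) (rule *)
  also have "\<dots> = (\<integral>\<^sup>+ l. (\<integral>\<^sup>+ m. f (shift_tuple n (\<lambda>i. line_angle (m i)) (star_map n l)) \<partial>?T) \<partial>?T)"
    by (rule TT.Fubini') measurable
  also have "\<dots> = (\<integral>\<^sup>+ l. (\<integral>\<^sup>+ m. f m \<partial>?T) \<partial>?T)"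
    using measurable_space[OF measurable_star_map[OF \<open>odd n\<close>]]
    by (intro nn_integral_cong nn_integral_shift_tuple' f) (auto simp: space_torus_measure)
  finally show ?thesis by (simp add: T.emeasure_space_1)
qed

lemma emeasure_star_map_vimage:
  assumes "odd n" "E \<in> sets (torus_measure n)"
  shows "emeasure (torus_measure n) (star_map n -` E \<inter> line_tuples n) = emeasure (torus_measure n) E"
proof -
  let ?T = "torus_measure n"
  have m: "star_map n -` E \<inter> line_tuples n \<in> sets ?T"
    using measurable_sets[OF measurable_star_map[OF assms(1)] assms(2)] by (simp add: space_torus_measure)
  have "emeasure ?T (star_map n -` E \<inter> line_tuples n)
    = (\<integral>\<^sup>+ l. indicator (star_map n -` E \<inter> line_tuples n) l \<partial>?T)"
    using m by simp
  also have "\<dots> = (\<integral>\<^sup>+ l. indicator E (star_map n l) \<partial>?T)"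
    by (intro nn_integral_cong) (auto simp: space_torus_measure indicator_def)
  also have "\<dots> = (\<integral>\<^sup>+ l. indicator E l \<partial>?T)"
    by (rule nn_integral_star_map) (use assms in auto)
  finally show ?thesis using assms by simp
qed

section \<open>Ergodicity\<close>

lemma line_angle_bounds: "0 \<le> line_angle (line_at a)" "line_angle (line_at a) < pi"
  using floor_divide_bounds[OF pi_gt_zero, of a] by (auto simp: line_angle_line_at)

lemma line_angle_right_continuous:
  "\<forall>\<^sub>F s in at_right 0. line_angle (line_at (c + s)) < b \<longleftrightarrow> line_angle (line_at c) < b"
proof -
  define r where "r = line_angle (line_at c)"
  have r: "0 \<le> r" "r < pi" unfolding r_def by (rule line_angle_bounds)+
  have add: "line_angle (line_at (c + s)) = r + s" if "0 \<le> r + s" "r + s < pi" for s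
  proof -
    have "line_at (c + s) = line_at (r + s)"
      using line_at_add_line_angle[of s c] by (simp add: r_def add.commute)
    moreover have "\<lfloor>(r + s) / pi\<rfloor> = 0" using that by (simp add: floor_eq_iff)
    ultimately show ?thesis by (simp add: line_angle_line_at)
  qed
  \<comment> \<open>Below this step size the angle r + s does not wrap around at \<pi>, and it does
    not reach b if r < b. If r is at least b, moving right keeps it there.\<close>
  define d where "d = (if r < b then min (pi - r) (b - r) else pi - r)"
  have "d > 0" using r by (auto simp: d_def)
  moreover have "line_angle (line_at (c + s)) < b \<longleftrightarrow> line_angle (line_at c) < b" if "0 < s" "s < d" for s
    using that r add[of s] unfolding r_def[symmetric] by (auto simp: d_def split: if_splits)
  ultimately show ?thesis unfolding eventually_at_right_field by blast
qed

text \<open>Boxes anchored at angle 0 with half-open sides: these sides make membership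
  right-continuous, and the boxes are closed under intersection.\<close>

definition angle_box :: "nat \<Rightarrow> (nat \<Rightarrow> real) \<Rightarrow> (nat \<Rightarrow> (real^2) set) set" where
  "angle_box n b = {l \<in> line_tuples n. \<forall>i\<in>{1..n}. line_angle (l i) < b i}"

lemma sets_angle_box [measurable]: "angle_box n b \<in> sets (torus_measure n)"
proof -
  have "{l \<in> space (torus_measure n). \<forall>i\<in>{1..n}. line_angle (l i) < b i} \<in> sets (torus_measure n)"
    by (intro sets.sets_Collect_finite_All borel_measurable_less measurable_torus_angle) auto
  then show ?thesis by (simp add: angle_box_def space_torus_measure)
qed

text \<open>Membership is a condition on finitely many coordinates, each eventually stable as its
  shift approaches from the right; hence the indicators are eventually equal.\<close>

lemma indicator_angle_box_tendsto:
  assumes "\<And>k i. i \<in> {1..n} \<Longrightarrow> x i < h k i \<and> h k i < x i + 1 / real (Suc k)"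
  shows "(\<lambda>k. indicator (angle_box n b) (shift_tuple n (h k) l) :: ennreal)
    \<longlonglongrightarrow> indicator (angle_box n b) (shift_tuple n x l)"
proof (rule tendsto_eventually)
  have "\<forall>\<^sub>F k in sequentially. line_angle (line_at (h k i + line_angle (l i))) < b i
      \<longleftrightarrow> line_angle (line_at (x i + line_angle (l i))) < b i" if i: "i \<in> {1..n}" for i
  proof -
    have "filterlim (\<lambda>k. h k i - x i) (at_right 0) sequentially"
      unfolding at_within_def filterlim_inf filterlim_principal
    proof
      show "(\<lambda>k. h k i - x i) \<longlonglongrightarrow> 0"
        by (rule real_tendsto_sandwich[OF _ _ tendsto_const LIMSEQ_inverse_real_of_nat])
          (use assms[OF i] in \<open>auto intro!: always_eventually less_imp_le simp: inverse_eq_divide algebra_simps\<close>)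
    qed (use assms[OF i] in auto)
    from eventually_compose_filterlim[OF line_angle_right_continuous this,
        of "x i + line_angle (l i)" "b i"]
    show ?thesis by (simp add: algebra_simps)
  qed
  then have "\<forall>\<^sub>F k in sequentially. \<forall>i\<in>{1..n}. line_angle (line_at (h k i + line_angle (l i))) < b i
      \<longleftrightarrow> line_angle (line_at (x i + line_angle (l i))) < b i"
    by (intro eventually_ball_finite) auto
  then show "\<forall>\<^sub>F k in sequentially. indicator (angle_box n b) (shift_tuple n (h k) l)
    = (indicator (angle_box n b) (shift_tuple n x l) :: ennreal)"
    by eventually_elim (auto simp: indicator_def angle_box_def shift_tuple_def, auto simp: tuple_at_def)
qed

lemma emeasure_Int_angle_box:
  assumes E [measurable]: "E \<in> sets (torus_measure n)"
    and dense: "\<And>x \<epsilon>. \<epsilon> > 0 \<Longrightarrow> \<exists>h. (\<forall>l\<in>line_tuples n. shift_tuple n h l \<in> E \<longleftrightarrow> l \<in> E) \<and>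
      (\<forall>i\<in>{1..n}. x i < h i \<and> h i < x i + \<epsilon>)"
  shows "emeasure (torus_measure n) (E \<inter> angle_box n b)
    = emeasure (torus_measure n) E * emeasure (torus_measure n) (angle_box n b)"
proof -
  let ?T = "torus_measure n" and ?B = "angle_box n b"
  interpret T: prob_space ?T by (rule prob_space_torus_measure)
  interpret TT: pair_sigma_finite ?T ?T ..
  \<comment> \<open>For a translation h preserving E the equality is translation invariance. An
    arbitrary x is a limit from the right of such h, and the constant 1 dominates on a probability
    space.\<close>
  have const: "emeasure ?T (E \<inter> ?B) = (\<integral>\<^sup>+ l. indicator E l * indicator ?B (shift_tuple n x l) \<partial>?T)" for x
  proof -
    from dense[of "1 / real (Suc k)" x for k] obtain h
      where inv: "\<And>k l. l \<in> line_tuples n \<Longrightarrow> shift_tuple n (h k) l \<in> E \<longleftrightarrow> l \<in> E"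
        and h: "\<And>k i. i \<in> {1..n} \<Longrightarrow> x i < h k i \<and> h k i < x i + 1 / real (Suc k)"
      by (metis of_nat_0_less_iff zero_less_Suc zero_less_divide_1_iff)
    have "(\<lambda>k. \<integral>\<^sup>+ l. indicator E l * indicator ?B (shift_tuple n (h k) l) \<partial>?T)
      \<longlonglongrightarrow> (\<integral>\<^sup>+ l. indicator E l * indicator ?B (shift_tuple n x l) \<partial>?T)"
    proof (rule nn_integral_dominated_convergence[where w = "\<lambda>_. 1"])
      show "AE l in ?T. (\<lambda>k. indicator E l * indicator ?B (shift_tuple n (h k) l) :: ennreal)
        \<longlonglongrightarrow> indicator E l * indicator ?B (shift_tuple n x l)"
      proof (rule AE_I2)
        fix l
        show "(\<lambda>k. indicator E l * indicator ?B (shift_tuple n (h k) l) :: ennreal)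
          \<longlonglongrightarrow> indicator E l * indicator ?B (shift_tuple n x l)"
          using indicator_angle_box_tendsto[OF h, where b = b and l = l] by (cases "l \<in> E") auto
      qed
    qed (auto simp: T.emeasure_space_1 indicator_def)
    moreover have "(\<integral>\<^sup>+ l. indicator E l * indicator ?B (shift_tuple n (h k) l) \<partial>?T) = emeasure ?T (E \<inter> ?B)" for k
    proof -
      have "(\<integral>\<^sup>+ l. indicator E l * indicator ?B (shift_tuple n (h k) l) \<partial>?T)
        = (\<integral>\<^sup>+ l. indicator (E \<inter> ?B) (shift_tuple n (h k) l) \<partial>?T)"
        by (intro nn_integral_cong) (auto simp: space_torus_measure indicator_def inv)
      also have "\<dots> = (\<integral>\<^sup>+ l. indicator (E \<inter> ?B) l \<partial>?T)"
        by (rule nn_integral_shift_tuple) measurable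
      finally show ?thesis by simp
    qed
    ultimately show ?thesis by (simp add: LIMSEQ_const_iff)
  qed
  \<comment> \<open>Averaging over all translations m: with l fixed, the translate of l is Haar
    distributed, so the integral over m gives the measure of the box.\<close>
  have "emeasure ?T (E \<inter> ?B) = (\<integral>\<^sup>+ m. emeasure ?T (E \<inter> ?B) \<partial>?T)"
    by (simp add: T.emeasure_space_1)
  also have "\<dots> = (\<integral>\<^sup>+ m. (\<integral>\<^sup>+ l. indicator E l * indicator ?B (shift_tuple n (\<lambda>i. line_angle (m i)) l) \<partial>?T) \<partial>?T)"
    by (rule nn_integral_cong) (rule const)
  also have "\<dots> = (\<integral>\<^sup>+ l. (\<integral>\<^sup>+ m. indicator E l * indicator ?B (shift_tuple n (\<lambda>i. line_angle (m i)) l) \<partial>?T) \<partial>?T)"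
    by (rule TT.Fubini') measurable
  also have "\<dots> = (\<integral>\<^sup>+ l. indicator E l * emeasure ?T ?B \<partial>?T)"
  proof (intro nn_integral_cong)
    fix l assume l: "l \<in> space ?T"
    have "(\<integral>\<^sup>+ m. indicator ?B (shift_tuple n (\<lambda>i. line_angle (m i)) l) \<partial>?T) = emeasure ?T ?B"
      using nn_integral_shift_tuple'[of "indicator ?B" n l] l by (simp add: space_torus_measure)
    then show "(\<integral>\<^sup>+ m. indicator E l * indicator ?B (shift_tuple n (\<lambda>i. line_angle (m i)) l) \<partial>?T)
      = indicator E l * emeasure ?T ?B"
      by (cases "l \<in> E") auto
  qed
  also have "\<dots> = emeasure ?T E * emeasure ?T ?B"
    by (subst nn_integral_multc) auto
  finally show ?thesis .
qed

section \<open>From boxes to all measurable sets\<close>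

lemma sets_PiM_borel_lessThan:
  assumes "finite I"
  shows "sets (\<Pi>\<^sub>M i\<in>I. borel :: real measure)
    = sigma_sets (\<Pi>\<^sub>E i\<in>I. UNIV) (range (\<lambda>b. \<Pi>\<^sub>E i\<in>I. {..<b i}))"
proof -
  have "sets (\<Pi>\<^sub>M i\<in>I. borel :: real measure)
    = sets (\<Pi>\<^sub>M i\<in>I. sigma UNIV (range (\<lambda>a::real. {..<a})))"
    by (simp only: borel_Iio)
  also have "\<dots> = sets (sigma (\<Pi>\<^sub>E i\<in>I. UNIV)
    {{f\<in>(\<Pi>\<^sub>E i\<in>I. UNIV). \<forall>i\<in>j. f i \<in> A i} | A j. j \<in> {I} \<and> A \<in> Pi j (\<lambda>_. range (\<lambda>a::real. {..<a}))})"
  proof (rule sets_PiM_sigma)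
    \<comment> \<open>A product of generated sigma-algebras is generated by full rectangles of
      generators when each factor is a countable union of generators.\<close>
    have "(UNIV :: real set) = (\<Union>k::nat. {..<real k})"
      using reals_Archimedean2 by auto
    then show "\<exists>S\<subseteq>range (\<lambda>a::real. {..<a}). countable S \<and> UNIV = \<Union>S" if "i \<in> I" for i
      by (intro exI[of _ "range (\<lambda>k::nat. {..<real k})"]) auto
  qed (use assms in auto)
  also have "{{f\<in>(\<Pi>\<^sub>E i\<in>I. UNIV). \<forall>i\<in>j. f i \<in> A i} | A j. j \<in> {I} \<and> A \<in> Pi j (\<lambda>_. range (\<lambda>a::real. {..<a}))}
    = range (\<lambda>b. \<Pi>\<^sub>E i\<in>I. {..<b i})" (is "?L = ?R")
  proof -
    have box: "{f\<in>(\<Pi>\<^sub>E i\<in>I. UNIV). \<forall>i\<in>I. f i \<in> A i} = Pi\<^sub>E I A" for A :: "_ \<Rightarrow> real set"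
      by (auto simp: PiE_def)
    have "\<exists>b. Pi\<^sub>E I A = (\<Pi>\<^sub>E i\<in>I. {..<b i})" if "A \<in> I \<rightarrow> range (\<lambda>a::real. {..<a})" for A
    proof -
      from that have "\<forall>i\<in>I. \<exists>a. A i = {..<a}" by (auto simp: Pi_iff)
      then obtain b where "\<forall>i\<in>I. A i = {..<b i}" by metis
      then show ?thesis by (intro exI[of _ b] PiE_cong) simp
    qed
    note lessThan = this
    show ?thesis
    proof (intro equalityI subsetI)
      fix X assume "X \<in> ?L"
      then obtain A where "X = {f\<in>(\<Pi>\<^sub>E i\<in>I. UNIV). \<forall>i\<in>I. f i \<in> A i}"
        and A: "A \<in> I \<rightarrow> range (\<lambda>a::real. {..<a})" by blast
      then have "X = Pi\<^sub>E I A" by (simp only: box)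
      with lessThan[OF A] show "X \<in> ?R" by (auto simp only:)
    next
      fix X assume "X \<in> ?R"
      then obtain b where "X = (\<Pi>\<^sub>E i\<in>I. {..<b i :: real})" by blast
      then have "X = {f\<in>(\<Pi>\<^sub>E i\<in>I. UNIV). \<forall>i\<in>I. f i \<in> {..<b i}}" by (simp only: box)
      then show "X \<in> ?L"
        by (intro CollectI exI[of _ "\<lambda>i. {..<b i}"] exI[of _ I] conjI) auto
    qed
  qed
  also have "sets (sigma (\<Pi>\<^sub>E i\<in>I. UNIV) ?R) = sigma_sets (\<Pi>\<^sub>E i\<in>I. UNIV) ?R"
    by (rule sets_measure_of) (auto simp: PiE_def)
  finally show ?thesis .
qed

text \<open>Both sides are finite measures in A. Pushed forward to angle vectors, they agree on an
  intersection-stable generator, hence everywhere.\<close>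

lemma emeasure_Int_torus:
  assumes E [measurable]: "E \<in> sets (torus_measure n)"
    and box: "\<And>b. emeasure (torus_measure n) (E \<inter> angle_box n b)
      = emeasure (torus_measure n) E * emeasure (torus_measure n) (angle_box n b)"
    and A [measurable]: "A \<in> sets (torus_measure n)"
  shows "emeasure (torus_measure n) (E \<inter> A)
      = emeasure (torus_measure n) E * emeasure (torus_measure n) A"
proof -
  let ?T = "torus_measure n" and ?R = "\<Pi>\<^sub>M i\<in>{1..n}. borel :: real measure"
  interpret T: prob_space ?T by (rule prob_space_torus_measure)
  define ang where "ang l = (\<lambda>i\<in>{1..n}. line_angle (l i))" for l :: "nat \<Rightarrow> (real^2) set"
  have ang [measurable]: "ang \<in> ?T \<rightarrow>\<^sub>M ?R"
    unfolding ang_def by (intro measurable_restrict measurable_torus_angle)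
  \<comment> \<open>The density \<open>indicator E\<close> produces the left-hand side, and the
    constant density \<open>emeasure ?T E\<close> the right-hand side.\<close>
  define P where "P c = distr (density ?T c) ?R ang" for c :: "_ \<Rightarrow> ennreal"
  have P: "emeasure (P (indicator E)) X = emeasure ?T (E \<inter> (ang -` X \<inter> line_tuples n))"
    "emeasure (P (\<lambda>_. emeasure ?T E)) X = emeasure ?T E * emeasure ?T (ang -` X \<inter> line_tuples n)"
    if "X \<in> sets ?R" for X
  proof -
    have [measurable]: "ang -` X \<inter> line_tuples n \<in> sets ?T"
      using measurable_sets[OF ang that] by (simp add: space_torus_measure)
    have "emeasure (P (indicator E)) X
      = (\<integral>\<^sup>+ l. indicator E l * indicator (ang -` X \<inter> line_tuples n) l \<partial>?T)"
      unfolding P_def using that ang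
      by (subst emeasure_distr) (auto simp: space_torus_measure emeasure_density)
    also have "\<dots> = (\<integral>\<^sup>+ l. indicator (E \<inter> (ang -` X \<inter> line_tuples n)) l \<partial>?T)"
      by (simp only: indicator_inter_arith)
    also have "\<dots> = emeasure ?T (E \<inter> (ang -` X \<inter> line_tuples n))"
      by (rule nn_integral_indicator) measurable
    finally show "emeasure (P (indicator E)) X = emeasure ?T (E \<inter> (ang -` X \<inter> line_tuples n))" .
    have "emeasure (P (\<lambda>_. emeasure ?T E)) X
      = emeasure (density ?T (\<lambda>_. emeasure ?T E)) (ang -` X \<inter> line_tuples n)"
      unfolding P_def using that ang by (subst emeasure_distr) (simp_all add: space_torus_measure)
    also have "\<dots> = emeasure ?T E * emeasure ?T (ang -` X \<inter> line_tuples n)"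
      by (rule emeasure_density_const) measurable
    finally show "emeasure (P (\<lambda>_. emeasure ?T E)) X
      = emeasure ?T E * emeasure ?T (ang -` X \<inter> line_tuples n)" .
  qed
  have vim: "ang -` (\<Pi>\<^sub>E i\<in>{1..n}. {..<b i}) \<inter> line_tuples n = angle_box n b" for b
    by (auto simp: ang_def angle_box_def PiE_iff)
  have meas: "(\<Pi>\<^sub>E i\<in>{1..n}. {..<b i}) \<in> sets ?R" for b :: "nat \<Rightarrow> real"
    by (intro sets_PiM_I_finite) auto
  have "P (indicator E) = P (\<lambda>_. emeasure ?T E)"
  proof (rule measure_eqI_generator_eq[where E = "range (\<lambda>b. \<Pi>\<^sub>E i\<in>{1..n}. {..<b i})"
        and \<Omega> = "\<Pi>\<^sub>E i\<in>{1..n}. UNIV" and A = "\<lambda>k. \<Pi>\<^sub>E i\<in>{1..n}. {..<real k}"])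
    show "Int_stable (range (\<lambda>b. \<Pi>\<^sub>E i\<in>{1..n}. {..<b i :: real}))"
    proof (rule Int_stableI)
      fix X Y assume "X \<in> range (\<lambda>b. \<Pi>\<^sub>E i\<in>{1..n}. {..<b i :: real})"
        "Y \<in> range (\<lambda>b. \<Pi>\<^sub>E i\<in>{1..n}. {..<b i :: real})"
      then obtain b c where "X = (\<Pi>\<^sub>E i\<in>{1..n}. {..<b i :: real})" "Y = (\<Pi>\<^sub>E i\<in>{1..n}. {..<c i :: real})"
        by blast
      then have "X \<inter> Y = (\<Pi>\<^sub>E i\<in>{1..n}. {..<min (b i) (c i)})" by (auto simp: PiE_iff)
      then show "X \<inter> Y \<in> range (\<lambda>b. \<Pi>\<^sub>E i\<in>{1..n}. {..<b i :: real})"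
        by (intro image_eqI[of _ _ "\<lambda>i. min (b i) (c i)"] UNIV_I)
    qed
    show "(\<Union>k. \<Pi>\<^sub>E i\<in>{1..n}. {..<real k}) = (\<Pi>\<^sub>E i\<in>{1..n}. UNIV)"
    proof (intro equalityI subsetI)
      fix f :: "nat \<Rightarrow> real" assume f: "f \<in> (\<Pi>\<^sub>E i\<in>{1..n}. UNIV)"
      \<comment> \<open>The sum of absolute values bounds all coordinates at once.\<close>
      obtain k :: nat where "(\<Sum>i\<in>{1..n}. \<bar>f i\<bar>) < real k" using reals_Archimedean2 by blast
      moreover have "f i \<le> (\<Sum>i\<in>{1..n}. \<bar>f i\<bar>)" if "i \<in> {1..n}" for i
        using member_le_sum[OF that, of "\<lambda>i. \<bar>f i\<bar>"] by auto
      ultimately have "f i < real k" if "i \<in> {1..n}" for i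
        using that by (meson le_less_trans)
      then have "f \<in> (\<Pi>\<^sub>E i\<in>{1..n}. {..<real k})"
        using f by (simp add: PiE_iff)
      then show "f \<in> (\<Union>k. \<Pi>\<^sub>E i\<in>{1..n}. {..<real k})" by blast
    qed (auto simp: PiE_iff)
    show "sets (P (indicator E)) = sigma_sets (\<Pi>\<^sub>E i\<in>{1..n}. UNIV) (range (\<lambda>b. \<Pi>\<^sub>E i\<in>{1..n}. {..<b i}))"
      "sets (P (\<lambda>_. emeasure ?T E)) = sigma_sets (\<Pi>\<^sub>E i\<in>{1..n}. UNIV) (range (\<lambda>b. \<Pi>\<^sub>E i\<in>{1..n}. {..<b i}))"
      using sets_PiM_borel_lessThan[of "{1..n}"] by (simp_all add: P_def)
    show "emeasure (P (indicator E)) X = emeasure (P (\<lambda>_. emeasure ?T E)) X"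
      if "X \<in> range (\<lambda>b. \<Pi>\<^sub>E i\<in>{1..n}. {..<b i})" for X
    proof -
      from that obtain b where "X = (\<Pi>\<^sub>E i\<in>{1..n}. {..<b i})" by blast
      then show ?thesis by (simp only: P[OF meas] vim box)
    qed
    show "emeasure (P (indicator E)) (\<Pi>\<^sub>E i\<in>{1..n}. {..<real k}) \<noteq> \<infinity>" for k
      by (simp add: P meas)
  qed (auto simp: PiE_iff)
  \<comment> \<open>Since \<open>tuple_at n\<close> undoes \<open>ang\<close> on line tuples, every
    measurable A is the preimage under \<open>ang\<close> of such an X, so nothing is lost in angle
    coordinates.\<close>
  moreover define X where "X = tuple_at n -` A \<inter> space ?R"
  have "(\<lambda>\<alpha>. tuple_at n \<alpha>) \<in> ?R \<rightarrow>\<^sub>M ?T"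
    by (rule measurable_tuple_at) measurable
  then have X: "X \<in> sets ?R" unfolding X_def by (rule measurable_sets) fact
  have "tuple_at n (ang l) = l" if "l \<in> line_tuples n" for l
    using tuple_at_line_angle[OF that] tuple_at_cong[of n "ang l" "\<lambda>i. line_angle (l i)"]
    by (simp add: ang_def)
  then have "ang -` X \<inter> line_tuples n = A"
    using sets.sets_into_space[OF A] by (auto simp: X_def space_torus_measure space_PiM ang_def)
  with P[OF X] \<open>P (indicator E) = P (\<lambda>_. emeasure ?T E)\<close> show ?thesis by simp
qed

section \<open>Zero-one law for invariant sets on the torus\<close>

lemma emeasure_invariant_torus:
  assumes "odd n" and E: "E \<in> sets (torus_measure n)"
    and star: "star_map n -` E \<inter> line_tuples n = E"
    and rot: "\<And>\<alpha> t. tuple_at n (\<lambda>i. t + \<alpha> i) \<in> E \<longleftrightarrow> tuple_at n \<alpha> \<in> E"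
  shows "emeasure (torus_measure n) E = 0 \<or> emeasure (torus_measure n) E = 1"
proof -
  let ?T = "torus_measure n"
  interpret T: prob_space ?T by (rule prob_space_torus_measure)
  \<comment> \<open>The translations that preserve E, taken as angle vectors.\<close>
  define H where "H = {h. \<forall>\<alpha>. tuple_at n (\<lambda>i. h i + \<alpha> i) \<in> E \<longleftrightarrow> tuple_at n \<alpha> \<in> E}"
  have star': "tuple_at n (star_angles n \<alpha>) \<in> E \<longleftrightarrow> tuple_at n \<alpha> \<in> E" for \<alpha>
  proof -
    have "tuple_at n \<alpha> \<in> E \<longleftrightarrow> tuple_at n \<alpha> \<in> star_map n -` E \<inter> line_tuples n"
      by (simp only: star)
    then show ?thesis by (simp add: star_map_tuple_at[OF \<open>odd n\<close>])
  qed
  have dense: "\<exists>h\<in>H. \<forall>i\<in>{1..n}. x i < h i \<and> h i < x i + \<epsilon>" if "\<epsilon> > 0" for x \<epsilon>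
  proof (rule dense_of_cyclic_mean_closed[OF \<open>odd n\<close>])
    show "(\<lambda>_. c) \<in> H" for c by (simp add: H_def rot)
    show "(\<lambda>i. v i + w i) \<in> H" if "v \<in> H" "w \<in> H" for v w
      using that by (simp add: H_def add.assoc)
    show "(\<lambda>i. of_int (z i) * pi) \<in> H" for z :: "nat \<Rightarrow> int"
    proof -
      have "line_at (of_int (z i) * pi + \<alpha> i) = line_at (\<alpha> i)" for \<alpha> i
        unfolding line_at_eq_iff by (rule exI[of _ "z i"]) simp
      then show ?thesis by (simp add: H_def tuple_at_def)
    qed
    \<comment> \<open>Applying the star map, which preserves membership in E, turns translation by
      \<open>cyclic_mean n v\<close> into translation by v.\<close>
    show "cyclic_mean n v \<in> H" if v: "v \<in> H" for v
    proof -
      have "tuple_at n (\<lambda>i. cyclic_mean n v i + \<alpha> i) \<in> E \<longleftrightarrow> tuple_at n \<alpha> \<in> E" for \<alpha>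
      proof -
        have "tuple_at n (\<lambda>i. cyclic_mean n v i + \<alpha> i) \<in> E
          \<longleftrightarrow> tuple_at n (\<lambda>i. v i + star_angles n \<alpha> i) \<in> E"
          using star'[of "\<lambda>i. cyclic_mean n v i + \<alpha> i"]
          by (simp add: star_angles_add star_angles_cyclic_mean[OF \<open>odd n\<close>])
        also have "\<dots> \<longleftrightarrow> tuple_at n \<alpha> \<in> E" using v by (simp add: H_def star')
        finally show ?thesis .
      qed
      then show ?thesis by (simp add: H_def)
    qed
  qed fact
  have shift: "shift_tuple n h l \<in> E \<longleftrightarrow> l \<in> E" if "h \<in> H" "l \<in> line_tuples n" for h l
  proof -
    from that obtain \<alpha> where "l = tuple_at n \<alpha>" by (auto simp: line_tuples_eq_range)
    with \<open>h \<in> H\<close> show ?thesis by (simp add: shift_tuple_at H_def)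
  qed
  have "emeasure ?T (E \<inter> angle_box n b) = emeasure ?T E * emeasure ?T (angle_box n b)" for b
  proof (rule emeasure_Int_angle_box[OF E])
    fix x :: "nat \<Rightarrow> real" and \<epsilon> :: real assume "\<epsilon> > 0"
    from dense[OF this, of x] obtain h where "h \<in> H" "\<forall>i\<in>{1..n}. x i < h i \<and> h i < x i + \<epsilon>" ..
    with shift show "\<exists>h. (\<forall>l\<in>line_tuples n. shift_tuple n h l \<in> E \<longleftrightarrow> l \<in> E) \<and>
      (\<forall>i\<in>{1..n}. x i < h i \<and> h i < x i + \<epsilon>)" by (intro exI[of _ h]) simp
  qed
  \<comment> \<open>E is independent of itself, so its measure equals its own square.\<close>
  from emeasure_Int_torus[OF E this E] have E2: "emeasure ?T E = emeasure ?T E * emeasure ?T E" by simp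
  define p where "p = T.prob E"
  have p: "emeasure ?T E = ennreal p" "p \<ge> 0" by (simp_all add: p_def T.emeasure_eq_measure)
  from E2 have "p = p * p" unfolding p(1) using p(2) by (simp flip: ennreal_mult)
  then have "p = 0 \<or> p = 1" by simp
  then show ?thesis unfolding p(1) by auto
qed

section \<open>The quotient torus\<close>

lemma in_sets_quotient_torus_iff:
  "A \<in> sets (quotient_torus n) \<longleftrightarrow>
     A \<subseteq> orbit n ` line_tuples n \<and> orbit n -` A \<inter> line_tuples n \<in> sets (torus_measure n)"
  by (simp add: quotient_torus_def sets_quotient_measure space_torus_measure)

lemma emeasure_quotient_torus:
  "A \<in> sets (quotient_torus n) \<Longrightarrow>
     emeasure (quotient_torus n) A = emeasure (torus_measure n) (orbit n -` A \<inter> line_tuples n)"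
  unfolding quotient_torus_def by (simp add: emeasure_quotient_measure space_torus_measure)

lemma star_map_in: "odd n \<Longrightarrow> star_map n \<in> line_tuples n \<rightarrow> line_tuples n"
  by (intro funcsetI) (simp add: star_map_eq)

text \<open>The quotient map intertwines the star map with the induced map, so preimages on the
  quotient can be computed on the torus.\<close>

lemma orbit_vimage_induced_map:
  assumes "odd n"
  shows "orbit n -` (induced_map n -` A \<inter> orbit n ` line_tuples n) \<inter> line_tuples n
    = star_map n -` (orbit n -` A \<inter> line_tuples n) \<inter> line_tuples n"
  using star_map_in[OF assms] by (auto simp: induced_map_orbit[OF assms])

lemma measure_preserving_induced_map:
  assumes "odd n"
  shows "measure_preserving (quotient_torus n) (induced_map n)"
proof -
  let ?Q = "quotient_torus n"
  have sets: "induced_map n -` A \<inter> space ?Q \<in> sets ?Q" if "A \<in> sets ?Q" for A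
    using that measurable_sets[OF measurable_star_map[OF assms], of "orbit n -` A \<inter> line_tuples n"]
    unfolding in_sets_quotient_torus_iff space_quotient_torus orbit_vimage_induced_map[OF assms]
    by (simp add: space_torus_measure)
  have "induced_map n \<in> ?Q \<rightarrow>\<^sub>M ?Q"
  proof (rule measurableI)
    show "induced_map n q \<in> space ?Q" if "q \<in> space ?Q" for q
      using that star_map_in[OF assms]
      by (auto simp: space_quotient_torus induced_map_orbit[OF assms])
  qed (rule sets)
  moreover have "emeasure ?Q (induced_map n -` A \<inter> space ?Q) = emeasure ?Q A" if A: "A \<in> sets ?Q" for A
    unfolding space_quotient_torus emeasure_quotient_torus[OF A]
      emeasure_quotient_torus[OF sets[OF A, unfolded space_quotient_torus]]
      orbit_vimage_induced_map[OF assms]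
    by (rule emeasure_star_map_vimage[OF assms]) (use A in \<open>simp add: in_sets_quotient_torus_iff\<close>)
  ultimately show ?thesis by (simp add: measure_preserving_def)
qed

text \<open>An invariant set lifts to a union of orbits, hence to a set invariant under both the
  star map and the diagonal rotations; the zero-one law on the torus applies to it.\<close>

lemma ergodic_induced_map:
  assumes "odd n"
  shows "ergodic (quotient_torus n) (induced_map n)"
  unfolding ergodic_def
proof (intro ballI impI)
  let ?Q = "quotient_torus n" and ?T = "torus_measure n"
  interpret T: prob_space ?T by (rule prob_space_torus_measure)
  fix A assume A: "A \<in> sets ?Q" and inv: "induced_map n -` A \<inter> space ?Q = A"
  define E where "E = orbit n -` A \<inter> line_tuples n"
  have E: "E \<in> sets ?T" using A by (simp add: E_def in_sets_quotient_torus_iff)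
  have "star_map n -` E \<inter> line_tuples n = E"
    unfolding E_def orbit_vimage_induced_map[OF assms, symmetric]
    using inv by (simp only: space_quotient_torus)
  moreover have "tuple_at n (\<lambda>i. t + \<alpha> i) \<in> E \<longleftrightarrow> tuple_at n \<alpha> \<in> E" for \<alpha> t
    using orbit_tuple_at[of n \<alpha> t] by (simp add: E_def add.commute)
  ultimately have "emeasure ?T E = 0 \<or> emeasure ?T E = 1"
    by (rule emeasure_invariant_torus[OF assms E])
  then show "A \<in> null_sets ?Q \<or> space ?Q - A \<in> null_sets ?Q"
  proof
    assume "emeasure ?T E = 0"
    then show ?thesis using A by (auto simp: null_sets_def emeasure_quotient_torus E_def)
  next
    assume 1: "emeasure ?T E = 1"
    have "orbit n -` (space ?Q - A) \<inter> line_tuples n = space ?T - E"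
      by (auto simp: E_def space_quotient_torus space_torus_measure)
    moreover have "emeasure ?T (space ?T - E) = 0"
      using E 1 by (subst emeasure_compl) (auto simp: T.emeasure_space_1)
    ultimately have "emeasure ?Q (space ?Q - A) = 0"
      using A by (simp add: emeasure_quotient_torus sets.compl_sets)
    then show ?thesis using A by (auto simp: null_sets_def)
  qed
qed

theorem theorem11:
  fixes n :: nat
  assumes "n \<ge> 3" and "odd n"
  shows "(\<forall>l\<in>line_tuples n. \<exists>!L. L \<in> lines \<and> reflect_in L = reflections l n)
    \<and> star_map n \<in> line_tuples n \<rightarrow> line_tuples n
    \<and> (\<forall>l\<in>line_tuples n. \<forall>t. star_map n (rotate_tuple n t l) = rotate_tuple n t (star_map n l))
    \<and> (\<forall>l\<in>line_tuples n. induced_map n (orbit n l) = orbit n (star_map n l))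
    \<and> measure_preserving (quotient_torus n) (induced_map n)
    \<and> ergodic (quotient_torus n) (induced_map n)"
proof (intro conjI ballI allI)
  show "star_map n \<in> line_tuples n \<rightarrow> line_tuples n"
    by (rule star_map_in[OF \<open>odd n\<close>])
  show "measure_preserving (quotient_torus n) (induced_map n)"
    by (rule measure_preserving_induced_map[OF \<open>odd n\<close>])
  show "ergodic (quotient_torus n) (induced_map n)"
    by (rule ergodic_induced_map[OF \<open>odd n\<close>])
  fix l assume l: "l \<in> line_tuples n"
  show "\<exists>!L. L \<in> lines \<and> reflect_in L = reflections l n"
    by (rule ex1_reflection_line[OF \<open>odd n\<close> l])
  show "star_map n (rotate_tuple n t l) = rotate_tuple n t (star_map n l)" for t
    by (rule star_map_rotate_tuple[OF \<open>odd n\<close> l])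
  show "induced_map n (orbit n l) = orbit n (star_map n l)"
    by (rule induced_map_orbit[OF \<open>odd n\<close> l])
qed

end
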